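(* For each curve $\alpha\in AC$ there is a reparametrization $\tilde\alpha$ of $\alpha$ which has constant speed and which produces the same measure: $\mu_{\tilde\alpha}=\mu_\alpha$.
   Context: $AC$ is the space of absolutely continuous curves $\alpha:[0,1]\to\mathbb{R}^d$ modulo translation. A reparametrization of $\alpha$ means an absolutely continuous curve of the form $\tilde\alpha=\alpha\circ\tilde\varphi$ with $\tilde\varphi:[0,1]\to[0,1]$ a strictly monotonic, right-continuous function. Constant speed means $|\tilde\alpha'(s)|$ is equal to a constant for almost every $s\in[0,1]$. $P^{d-1}$ is real projective space of dimension $d-1$, and $\pi:S^{d-1}\to P^{d-1}$ is the projection identifying antipodal points. For $f\in C(P^{d-1})$, $\hat f:\mathbb{R}^d\to\mathbb{R}$ denotes the degree $1$ homogeneous extension $\hat f(r\xi)=|r|\,f(\pi(\xi))$ for $r\in\mathbb{R}$, $\xi\in S^{d-1}$. For $\alpha\in AC$, $\mu_\alpha$ is the unique finite positive Borel measure on $P^{d-1}$ with $\int f\,d\mu_\alpha=\int_0^1\hat f(\alpha'(t))\,dt$ for all $f\in C(P^{d-1})$. *)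

theory Defs
  imports "HOL-Analysis.Analysis"
begin

section \<open>Real projective space as a quotient of the unit sphere\<close>

definition antipodal :: "real ^ 'n \<Rightarrow> real ^ 'n \<Rightarrow> bool" where
  "antipodal x y \<longleftrightarrow> norm x = 1 \<and> norm y = 1 \<and> (x = y \<or> x = - y)"

lemma antipodal_part_equivp: "part_equivp antipodal"
proof (rule part_equivpI)
  have "antipodal (axis undefined 1) (axis undefined 1)"
    by (simp add: antipodal_def)
  then show "\<exists>x. antipodal x x" ..
qed (auto simp: symp_def transp_def antipodal_def)

text \<open>Only unit vectors are related to themselves, so the elements of the quotient are
  exactly the sets \<open>{x, - x}\<close> with \<open>x\<close> on the unit sphere.\<close>

quotient_type (overloaded) 'n proj_space = "real ^ 'n::finite" / partial: antipodal
  by (rule antipodal_part_equivp)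

text \<open>The projection \<open>\<pi>\<close>; it is meaningful on \<open>sphere 0 1\<close> only.\<close>

definition proj :: "real ^ 'n \<Rightarrow> 'n proj_space" where
  "proj = abs_proj_space"

lemma proj_eq_iff:
  assumes "norm x = 1" and "norm y = 1"
  shows "proj x = proj y \<longleftrightarrow> x = y \<or> x = - y"
  using assms Quotient_rel[OF Quotient_proj_space, of x y]
  by (auto simp: proj_def antipodal_def)

lemma proj_surj: "proj ` sphere 0 1 = UNIV"
proof -
  have "p \<in> proj ` sphere 0 1" for p :: "('n::finite) proj_space"
  proof
    show "p = proj (rep_proj_space p)"
      by (simp add: proj_def Quotient_abs_rep[OF Quotient_proj_space])
    show "rep_proj_space p \<in> sphere 0 1"
      using Quotient_rep_reflp[OF Quotient_proj_space, of p] by (simp add: antipodal_def)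
  qed
  then show ?thesis by blast
qed

instantiation proj_space :: (finite) topological_space
begin

definition open_proj_space :: "'a proj_space set \<Rightarrow> bool" where
  "open_proj_space U \<longleftrightarrow>
     openin (top_of_set (sphere 0 1)) {x \<in> sphere 0 1. proj x \<in> U}"

instance
proof
  have "{x \<in> sphere 0 1. proj x \<in> (UNIV :: 'a proj_space set)} = sphere 0 1"
    by blast
  then show "open (UNIV :: 'a proj_space set)"
    unfolding open_proj_space_def by (metis openin_subtopology_self)
next
  fix U V :: "'a proj_space set"
  assume "open U" "open V"
  then have "openin (top_of_set (sphere 0 1))
      ({x \<in> sphere 0 1. proj x \<in> U} \<inter> {x \<in> sphere 0 1. proj x \<in> V})"
    unfolding open_proj_space_def by (rule openin_Int)
  moreover have "{x \<in> sphere 0 1. proj x \<in> U \<inter> V} =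
      {x \<in> sphere 0 1. proj x \<in> U} \<inter> {x \<in> sphere 0 1. proj x \<in> V}"
    by blast
  ultimately show "open (U \<inter> V)"
    by (simp only: open_proj_space_def)
next
  fix K :: "'a proj_space set set"
  assume "\<forall>U\<in>K. open U"
  then have "openin (top_of_set (sphere 0 1)) (\<Union>U\<in>K. {x \<in> sphere 0 1. proj x \<in> U})"
    unfolding open_proj_space_def by (intro openin_Union) blast
  moreover have "{x \<in> sphere 0 1. proj x \<in> \<Union> K} =
      (\<Union>U\<in>K. {x \<in> sphere 0 1. proj x \<in> U})"
    by blast
  ultimately show "open (\<Union> K)"
    by (simp only: open_proj_space_def)
qed

end

lemma quotient_map_proj: "quotient_map (top_of_set (sphere 0 1)) euclidean proj"
  unfolding quotient_map_def topspace_euclidean_subtopology topspace_euclidean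
    open_openin[symmetric] open_proj_space_def
  by (simp only: proj_surj subset_UNIV simp_thms)

section \<open>Degree one homogeneous extension\<close>

definition hom_ext :: "('n proj_space \<Rightarrow> real) \<Rightarrow> real ^ 'n \<Rightarrow> real" where
  "hom_ext f v = norm v * f (proj (v /\<^sub>R norm v))"

lemma hom_ext_scaleR:
  assumes "norm \<xi> = 1"
  shows "hom_ext f (r *\<^sub>R \<xi>) = \<bar>r\<bar> * f (proj \<xi>)"
proof (cases "r = 0")
  case False
  have "proj (sgn r *\<^sub>R \<xi>) = proj \<xi>"
    using assms False by (subst proj_eq_iff) (auto simp: sgn_real_def)
  with assms False show ?thesis
    by (simp add: hom_ext_def sgn_real_def split: if_splits)
qed (simp add: hom_ext_def)

section \<open>Absolutely continuous curves and their reparametrizations\<close>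

text \<open>Curves are functions on \<open>real\<close> of which only the restriction to \<open>{0..1}\<close> matters.\<close>

definition abs_cont_curve :: "(real \<Rightarrow> real ^ 'n) \<Rightarrow> bool" where
  "abs_cont_curve \<alpha> \<longleftrightarrow>
     (\<forall>\<epsilon>>0. \<exists>\<delta>>0. \<forall>D :: (real \<times> real) set.
        finite D \<longrightarrow> (\<forall>(a, b)\<in>D. 0 \<le> a \<and> a \<le> b \<and> b \<le> 1) \<longrightarrow>
        pairwise (\<lambda>(a, b) (c, d). disjnt {a<..<b} {c<..<d}) D \<longrightarrow>
        (\<Sum>(a, b)\<in>D. b - a) < \<delta> \<longrightarrow>
        (\<Sum>(a, b)\<in>D. norm (\<alpha> b - \<alpha> a)) < \<epsilon>)"

definition reparametrization :: "(real \<Rightarrow> real ^ 'n) \<Rightarrow> (real \<Rightarrow> real ^ 'n) \<Rightarrow> bool" where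
  "reparametrization \<beta> \<alpha> \<longleftrightarrow>
     abs_cont_curve \<beta> \<and>
     (\<exists>\<phi> \<in> {0..1} \<rightarrow> {0..1}.
        (strict_mono_on {0..1} \<phi> \<or> strict_antimono_on {0..1} \<phi>) \<and>
        (\<forall>s\<in>{0..<1}. continuous (at_right s) \<phi>) \<and>
        (\<forall>s\<in>{0..1}. \<beta> s = \<alpha> (\<phi> s)))"

definition constant_speed :: "(real \<Rightarrow> real ^ 'n) \<Rightarrow> bool" where
  "constant_speed \<alpha> \<longleftrightarrow>
     (\<exists>c. AE s in lebesgue. s \<in> {0..1} \<longrightarrow>
        (\<exists>v. (\<alpha> has_vector_derivative v) (at s within {0..1}) \<and> norm v = c))"

section \<open>The measure of a curve\<close>

definition curve_measure :: "(real \<Rightarrow> real ^ 'n) \<Rightarrow> 'n proj_space measure" where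
  "curve_measure \<alpha> = (THE \<mu>. sets \<mu> = sets borel \<and> finite_measure \<mu> \<and>
     (\<forall>f. continuous_on UNIV f \<longrightarrow>
        (\<integral>p. f p \<partial>\<mu>) =
        (LINT t:{0..1}|lebesgue. hom_ext f (vector_derivative \<alpha> (at t within {0..1})))))"

section \<open>Invariance under translations\<close>

text \<open>The notions above therefore depend only on the class of a curve modulo translations.\<close>

lemma abs_cont_curve_translate: "abs_cont_curve (\<lambda>t. \<alpha> t + v) \<longleftrightarrow> abs_cont_curve \<alpha>"
  by (simp add: abs_cont_curve_def)

lemma reparametrization_translate:
  "reparametrization (\<lambda>t. \<beta> t + v) (\<lambda>t. \<alpha> t + v) \<longleftrightarrow> reparametrization \<beta> \<alpha>"
  by (simp add: reparametrization_def abs_cont_curve_translate)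

lemma has_vector_derivative_translate:
  "((\<lambda>t. \<alpha> t + v) has_vector_derivative d) F \<longleftrightarrow> (\<alpha> has_vector_derivative d) F"
  by (simp add: has_vector_derivative_def has_derivative_def)

lemma constant_speed_translate: "constant_speed (\<lambda>t. \<alpha> t + v) \<longleftrightarrow> constant_speed \<alpha>"
  by (simp add: constant_speed_def has_vector_derivative_translate)

lemma curve_measure_translate: "curve_measure (\<lambda>t. \<alpha> t + v) = curve_measure \<alpha>"
  by (simp add: curve_measure_def vector_derivative_def has_vector_derivative_translate)

end

theory Submission
  imports Defs
begin

text \<open>
  The curve \<open>\<beta>\<close> is the parametrization of \<open>\<alpha>\<close> by normalised arc length. An absolutely continuous
  curve is the integral of its almost everywhere defined derivative \<open>g\<close>. Let \<open>L\<close> be the integral of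
  \<open>norm g\<close>. If \<open>L = 0\<close>, then \<open>\<alpha>\<close> is constant and is its own reparametrization. Otherwise
  \<open>m = norm g / L\<close> is a probability density on the unit interval. Write \<open>\<sigma>\<close> for its distribution
  function, and let \<open>\<phi> s\<close> be the largest \<open>t\<close> in the unit interval with \<open>\<sigma> t \<le> s\<close>: this is a right
  inverse of \<open>\<sigma>\<close>, strictly increasing because \<open>\<sigma>\<close> is a function, and right-continuous because it
  always takes the right end of the intervals on which \<open>\<sigma>\<close>, hence \<open>\<alpha>\<close>, is constant. Put
  \<open>\<beta> = \<alpha> \<circ> \<phi>\<close>.

  Since \<open>\<alpha>\<close> moves by at most \<open>L\<close> times the increment of \<open>\<sigma>\<close>, the curve \<open>\<beta>\<close> is Lipschitz with
  constant \<open>L\<close> and \<open>\<alpha> = \<beta> \<circ> \<sigma>\<close>. So \<open>\<beta>\<close> is absolutely continuous, with a derivative \<open>b\<close>, and the chain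
  rule gives \<open>g t = m t *\<^sub>R b (\<sigma> t)\<close> for almost every \<open>t\<close>: the times that \<open>\<sigma>\<close> sends into the null set where
  \<open>\<beta>\<close> is not differentiable carry no mass of \<open>m\<close>, so that \<open>g\<close> vanishes almost everywhere on them. Now \<open>\<sigma>\<close>
  pushes the measure with density \<open>m\<close> forward to Lebesgue measure on the unit interval. Taking norms
  therefore gives \<open>norm b = L\<close> almost everywhere, which is constant speed. Applying a positively
  homogeneous function and substituting \<open>s = \<sigma> t\<close> gives equal integrals for \<open>\<alpha>\<close> and \<open>\<beta>\<close>, which is
  equality of the measures, since a curve measure is determined by these integrals.

  The analysis behind this is the fundamental theorem of calculus for absolutely continuous
  functions, \<open>abs_cont_curve_ex_density\<close>. It combines the Lebesgue differentiation theorem on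
  the line, obtained from the Vitali covering theorem, with the Radon-Nikodym theorem for the Stieltjes
  measure of an absolutely continuous monotone function; the total variation function reduces the
  general case to the monotone one.
\<close>

section \<open>Lebesgue differentiation theorem on the line\<close>

lemma integral_nonneg_imp_neg_part_le_pos_part:
  fixes q :: "real \<Rightarrow> real"
  assumes q: "integrable lborel q" and K: "K \<in> sets borel"
    and pos: "0 \<le> (LINT t:K|lborel. q t)"
  shows "emeasure (density lborel (\<lambda>x. ennreal (- q x))) K \<le> emeasure (density lborel (\<lambda>x. ennreal (q x))) K"
proof -
  have [measurable]: "q \<in> borel_measurable borel"
    using borel_measurable_integrable[OF q] by simp
  have K'[measurable]: "K \<in> sets lborel" using K by simp
  let ?f = "\<lambda>x. indicator K x * q x"
  have i: "integrable lborel ?f"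
    using integrable_mult_indicator[OF K' q] by simp
  have p: "(\<integral>\<^sup>+x. ennreal (q x) * indicator K x \<partial>lborel) = (\<integral>\<^sup>+x. ennreal (?f x) \<partial>lborel)"
    by (intro nn_integral_cong) (simp split: split_indicator)
  have n: "(\<integral>\<^sup>+x. ennreal (- q x) * indicator K x \<partial>lborel) = (\<integral>\<^sup>+x. ennreal (- ?f x) \<partial>lborel)"
    by (intro nn_integral_cong) (simp split: split_indicator)
  have "0 \<le> enn2real (\<integral>\<^sup>+x. ennreal (?f x) \<partial>lborel) - enn2real (\<integral>\<^sup>+x. ennreal (- ?f x) \<partial>lborel)"
    using pos real_lebesgue_integral_def[OF i] by (simp add: set_lebesgue_integral_def)
  then have "enn2real (\<integral>\<^sup>+x. ennreal (- ?f x) \<partial>lborel) \<le> enn2real (\<integral>\<^sup>+x. ennreal (?f x) \<partial>lborel)" by simp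
  moreover have "(\<integral>\<^sup>+x. ennreal (- ?f x) \<partial>lborel) < \<infinity>" "(\<integral>\<^sup>+x. ennreal (?f x) \<partial>lborel) < \<infinity>"
    using i by (auto simp: real_integrable_def top.not_eq_extremum)
  ultimately have "(\<integral>\<^sup>+x. ennreal (- ?f x) \<partial>lborel) \<le> (\<integral>\<^sup>+x. ennreal (?f x) \<partial>lborel)"
    by (cases "\<integral>\<^sup>+x. ennreal (- ?f x) \<partial>lborel"; cases "\<integral>\<^sup>+x. ennreal (?f x) \<partial>lborel")
       (auto simp: ennreal_leI)
  then show ?thesis using K by (simp add: emeasure_density p n)
qed

text \<open>
  Let \<open>P\<close> and \<open>N\<close> be the measures whose densities are the positive and negative parts of \<open>q\<close>. The set \<open>A\<close>
  where \<open>q\<close> is at most \<open>- \<rho>\<close> is null for \<open>P\<close>, so it has an open neighbourhood \<open>U\<close> with arbitrarily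
  small \<open>P\<close>-measure. Vitali's theorem fills \<open>E\<close>, up to a null set, with disjoint intervals inside \<open>U\<close> on
  which \<open>N\<close> is at most \<open>P\<close>. On the union of these intervals \<open>N\<close> is thus small, whereas it is at least
  \<open>\<rho>\<close> times Lebesgue measure on \<open>A\<close>.
\<close>

lemma negligible_if_small_intervals_overshoot:
  fixes q :: "real \<Rightarrow> real"
  assumes q: "integrable lborel q" and "\<rho> > 0"
    and neg: "\<And>x. x \<in> E \<Longrightarrow> q x \<le> - \<rho>"
    and fine: "\<And>x d. x \<in> E \<Longrightarrow> 0 < d \<Longrightarrow>
      \<exists>a b. a < b \<and> a \<le> x \<and> x \<le> b \<and> b - a < d \<and> 0 \<le> (LINT t:{a..b}|lborel. q t)"
  shows "negligible E"
  unfolding negligible_outer_le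
proof (intro allI impI)
  fix e :: real assume "e > 0"
  have q_borel[measurable]: "q \<in> borel_measurable borel"
    using borel_measurable_integrable[OF q] by simp
  define P where "P = density lborel (\<lambda>x. ennreal (q x))"
  define N where "N = density lborel (\<lambda>x. ennreal (- q x))"
  have [simp]: "sets P = sets borel" "sets N = sets borel" "space P = UNIV"
    by (simp_all add: P_def N_def)
  define A where "A = {x. q x \<le> - \<rho>}"
  have A_borel[measurable]: "A \<in> sets borel" unfolding A_def by measurable
  have "emeasure P A = (\<integral>\<^sup>+x. ennreal (q x) * indicator A x \<partial>lborel)"
    by (simp add: P_def emeasure_density)
  also have "\<dots> = (\<integral>\<^sup>+x. 0 \<partial>(lborel :: real measure))"
    using \<open>\<rho> > 0\<close> by (intro nn_integral_cong) (auto simp: A_def ennreal_neg split: split_indicator)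
  finally have PA: "emeasure P A = 0" by simp
  have "emeasure P (space P) \<noteq> \<infinity>"
    using q by (auto simp: P_def emeasure_density real_integrable_def)
  then have "(INF U \<in> {U. A \<subseteq> U \<and> open U}. emeasure P U) = 0"
    using outer_regular[of P A] PA by simp
  then have "(INF U \<in> {U. A \<subseteq> U \<and> open U}. emeasure P U) < ennreal (\<rho> * e)"
    using \<open>e > 0\<close> \<open>\<rho> > 0\<close> by simp
  then obtain U where U: "A \<subseteq> U" "open U" "emeasure P U < ennreal (\<rho> * e)"
    unfolding INF_less_iff by auto
  define K where "K = {(a, b). a < b \<and> {a..b} \<subseteq> U \<and> 0 \<le> (LINT t:{a..b}|lborel. q t)}"
  define mid where "mid = (\<lambda>(a, b). (a + b) / 2 :: real)"
  define rad where "rad = (\<lambda>(a, b). (b - a) / 2 :: real)"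
  have cb: "cball (mid p) (rad p) = {fst p..snd p}" for p
    by (cases p) (auto simp: mid_def rad_def cball_eq_atLeastAtMost field_simps)
  have rad_pos: "0 < rad p" if "p \<in> K" for p using that by (auto simp: K_def rad_def)
  have cov: "\<exists>p. p \<in> K \<and> x \<in> cball (mid p) (rad p) \<and> rad p < d" if "x \<in> E" "0 < d" for x d
  proof -
    have "x \<in> U" using that neg U by (auto simp: A_def)
    then obtain r where r: "r > 0" "ball x r \<subseteq> U"
      using \<open>open U\<close> open_contains_ball by blast
    then obtain a b where ab: "a < b" "a \<le> x" "x \<le> b" "b - a < min r d" "0 \<le> (LINT t:{a..b}|lborel. q t)"
      using fine[OF \<open>x \<in> E\<close>, of "min r d"] \<open>0 < d\<close> by auto
    have "{a..b} \<subseteq> ball x r" using ab by (auto simp: dist_real_def)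
    then have "(a, b) \<in> K" using ab r by (auto simp: K_def)
    moreover have "rad (a, b) < d" using ab by (auto simp: rad_def)
    ultimately show ?thesis using ab cb[of "(a, b)"] by (intro exI[of _ "(a, b)"]) auto
  qed
  obtain C where C: "countable C" "C \<subseteq> K"
    "pairwise (\<lambda>i j. disjnt (cball (mid i) (rad i)) (cball (mid j) (rad j))) C"
    "negligible (E - (\<Union>i\<in>C. cball (mid i) (rad i)))"
    using Vitali_covering_theorem_cballs[of K rad E mid, OF rad_pos cov] by blast
  define J where "J = (\<Union>i\<in>C. {fst i..snd i})"
  have J_borel[measurable]: "J \<in> sets borel" unfolding J_def using C(1) by (intro sets.countable_UN') auto
  have disj: "disjoint_family_on (\<lambda>i. {fst i..snd i}) C"
    using C(3) by (auto simp: disjoint_family_on_def pairwise_def disjnt_def cb)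
  have J_sum: "emeasure M J = (\<integral>\<^sup>+i. emeasure M {fst i..snd i} \<partial>count_space C)"
    if "sets M = sets borel" for M :: "real measure"
    unfolding J_def using C(1) disj that by (intro emeasure_UN_countable) auto
  have "emeasure N {fst i..snd i} \<le> emeasure P {fst i..snd i}" if "i \<in> C" for i
    unfolding N_def P_def using that C(2)
    by (intro integral_nonneg_imp_neg_part_le_pos_part[OF q]) (auto simp: K_def)
  then have NJ: "emeasure N J \<le> emeasure P J"
    unfolding J_sum[of N, simplified] J_sum[of P, simplified]
    by (intro nn_integral_mono) simp
  have "ennreal \<rho> * emeasure lborel (J \<inter> A) = (\<integral>\<^sup>+x. ennreal \<rho> * indicator (J \<inter> A) x \<partial>lborel)"
    by (simp add: nn_integral_cmult_indicator)
  also have "\<dots> \<le> (\<integral>\<^sup>+x. ennreal (- q x) * indicator J x \<partial>lborel)"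
    by (intro nn_integral_mono) (auto simp: A_def ennreal_leI split: split_indicator)
  also have "\<dots> = emeasure N J" by (simp add: N_def emeasure_density)
  also note NJ
  also have "emeasure P J \<le> emeasure P U"
    using C(2) \<open>open U\<close> by (intro emeasure_mono) (fastforce simp: J_def K_def)+
  also note U(3)
  finally have "ennreal \<rho> * emeasure lborel (J \<inter> A) < ennreal (\<rho> * e)" .
  then have "ennreal \<rho> * emeasure lborel (J \<inter> A) < ennreal \<rho> * ennreal e"
    using \<open>\<rho> > 0\<close> \<open>e > 0\<close> by (simp add: ennreal_mult)
  then have small: "emeasure lborel (J \<inter> A) < ennreal e"
    by (metis mult_left_mono not_le zero_le)
  let ?N = "E - J"
  have "negligible ?N" using C(4) by (simp add: J_def cb)
  then have null: "?N \<in> null_sets lebesgue" by (simp add: negligible_iff_null_sets)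
  have JA: "J \<inter> A \<in> lmeasurable"
    using small by (intro fmeasurableI) (auto simp: top.not_eq_extremum[symmetric] less_top[symmetric])
  have "E \<subseteq> J \<inter> A \<union> ?N" using neg by (auto simp: A_def)
  moreover have "J \<inter> A \<union> ?N \<in> lmeasurable"
    using JA \<open>negligible ?N\<close> by (intro fmeasurable.Un) (auto simp: negligible_iff_measure)
  moreover have "measure lebesgue (J \<inter> A \<union> ?N) \<le> e"
  proof -
    have "measure lebesgue (J \<inter> A \<union> ?N) = measure lebesgue (J \<inter> A)"
      using JA null by (intro measure_Un_null_set) auto
    also have "\<dots> = measure lborel (J \<inter> A)" by (simp)
    also have "\<dots> \<le> e" using small \<open>e > 0\<close>
      by (simp add: measure_def) (metis enn2real_leI less_imp_le)
    finally show ?thesis .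
  qed
  ultimately show "\<exists>T. E \<subseteq> T \<and> T \<in> lmeasurable \<and> measure lebesgue T \<le> e" by blast
qed

lemma AE_lborel_if_negligible:
  assumes "negligible N" "\<And>x. x \<notin> N \<Longrightarrow> P x"
  shows "AE x in lborel. P x"
proof -
  have "AE x in lebesgue. x \<notin> N"
    using assms(1) by (simp add: negligible_iff_null_sets AE_not_in)
  then have "AE x in lebesgue. P x" using assms(2) by (auto elim: eventually_mono)
  then show ?thesis by (simp add: AE_completion_iff)
qed

text \<open>
  At an exceptional point some rational numbers \<open>r < s\<close> satisfy \<open>h x \<le> r\<close> while arbitrarily small intervals
  around \<open>x\<close> have average at least \<open>s\<close>. Hence \<open>negligible_if_small_intervals_overshoot\<close>, applied to
  \<open>h - s\<close>, excludes it. That function is cut off to a bounded interval to make it integrable, which is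
  where the third parameter \<open>k\<close> below comes from.
\<close>

lemma AE_small_interval_averages_less:
  fixes h :: "real \<Rightarrow> real"
  assumes h: "integrable lborel h"
  shows "AE x in lborel. \<forall>s>h x. \<exists>d>0. \<forall>a b. a < b \<longrightarrow> a \<le> x \<longrightarrow> x \<le> b \<longrightarrow> b - a < d \<longrightarrow>
    (LINT t:{a..b}|lborel. h t) < s * (b - a)"
proof -
  define E where "E = (\<lambda>(r, s, k). {x. \<bar>x\<bar> < real k \<and> h x \<le> r \<and>
    (\<forall>d>0. \<exists>a b. a < b \<and> a \<le> x \<and> x \<le> b \<and> b - a < d \<and> s * (b - a) \<le> (LINT t:{a..b}|lborel. h t))})"
  have E_null: "negligible (E (r, s, k))" if "r < s" for r s k
  proof (rule negligible_if_small_intervals_overshoot)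
    define q where "q = (\<lambda>x. indicator {- real k<..<real k} x * (h x - s))"
    show "integrable lborel q"
    proof -
      have "integrable lborel (\<lambda>x. indicator {- real k<..<real k} x *\<^sub>R h x - s * indicator {- real k<..<real k} x)"
        using h by (intro Bochner_Integration.integrable_diff integrable_mult_indicator
          integrable_mult_right integrable_real_indicator) auto
      then show ?thesis by (simp add: q_def algebra_simps)
    qed
    show "0 < s - r" using that by simp
    show "q x \<le> - (s - r)" if "x \<in> E (r, s, k)" for x
      using that by (auto simp: E_def q_def abs_less_iff)
    show "\<exists>a b. a < b \<and> a \<le> x \<and> x \<le> b \<and> b - a < d \<and> 0 \<le> (LINT t:{a..b}|lborel. q t)"
      if x: "x \<in> E (r, s, k)" and "0 < d" for x d
    proof -
      have "0 < min d (min (k - x) (k + x))" using that by (auto simp: E_def abs_less_iff)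
      then obtain a b where ab: "a < b" "a \<le> x" "x \<le> b" "b - a < min d (min (k - x) (k + x))"
        "s * (b - a) \<le> (LINT t:{a..b}|lborel. h t)"
        using x unfolding E_def by blast
      have "(LINT t:{a..b}|lborel. q t) = (LINT t:{a..b}|lborel. h t - s)"
        using ab by (intro set_lebesgue_integral_cong) (auto simp: q_def)
      also have "\<dots> = (LINT t:{a..b}|lborel. h t) - (LINT t:{a..b}|lborel. s)"
        using integrable_mult_indicator[OF _ h, of "{a..b}"]
        by (intro set_integral_diff)
           (auto simp: set_integrable_def emeasure_lborel_Icc_eq intro!: integrable_mult_left integrable_real_indicator)
      also have "(LINT t:{a..b}|lborel. s) = s * (b - a)"
        using ab by (simp add: set_lebesgue_integral_def)
      finally show ?thesis using ab by (intro exI[of _ a] exI[of _ b]) auto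
    qed
  qed
  define T :: "(real \<times> real \<times> nat) set" where "T = {(r, s, k). r \<in> \<rat> \<and> s \<in> \<rat> \<and> r < s}"
  have "countable (\<rat> \<times> \<rat> \<times> (UNIV :: nat set))" by (intro countable_SIGMA countable_rat) auto
  then have "countable T" by (rule countable_subset[rotated]) (auto simp: T_def)
  then have "negligible (\<Union>i\<in>T. E i)"
    using E_null by (intro negligible_countable_Union) (auto simp: T_def)
  then show ?thesis
  proof (rule AE_lborel_if_negligible, intro allI impI)
    fix x s assume x: "x \<notin> (\<Union>i\<in>T. E i)" and s: "h x < s"
    obtain r' where r': "r' \<in> \<rat>" "h x < r'" "r' < s" using Rats_dense_in_real[OF s] by blast
    obtain r where r: "r \<in> \<rat>" "h x < r" "r < r'" using Rats_dense_in_real[OF r'(2)] by blast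
    obtain k :: nat where "\<bar>x\<bar> < k" using reals_Archimedean2 by blast
    moreover have "x \<notin> E (r, r', k)" using x r r' by (auto simp: T_def)
    ultimately obtain d where d: "d > 0"
      "\<And>a b. a < b \<Longrightarrow> a \<le> x \<Longrightarrow> x \<le> b \<Longrightarrow> b - a < d \<Longrightarrow> (LINT t:{a..b}|lborel. h t) < r' * (b - a)"
      using r(2) unfolding E_def by (simp add: not_le) (metis not_le)
    have "(LINT t:{a..b}|lborel. h t) < s * (b - a)" if "a < b" "a \<le> x" "x \<le> b" "b - a < d" for a b
    proof -
      have "r' * (b - a) \<le> s * (b - a)" using that r' by (intro mult_right_mono) auto
      with d(2)[OF that] show ?thesis by simp
    qed
    with d(1) show "\<exists>d>0. \<forall>a b. a < b \<longrightarrow> a \<le> x \<longrightarrow> x \<le> b \<longrightarrow> b - a < d \<longrightarrow>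
      (LINT t:{a..b}|lborel. h t) < s * (b - a)" by blast
  qed
qed

text \<open>
  Lebesgue's differentiation theorem. The averages over the intervals with \<open>x\<close> as an end point are bounded
  above and below by applying the preceding estimate to \<open>h\<close> and to \<open>- h\<close>.
\<close>

theorem AE_has_real_derivative_indefinite_integral:
  fixes h F :: "real \<Rightarrow> real"
  assumes h: "integrable lborel h"
    and F: "\<And>a b. a \<le> b \<Longrightarrow> F b - F a = (LINT t:{a..b}|lborel. h t)"
  shows "AE x in lborel. (F has_real_derivative h x) (at x)"
proof -
  have "AE x in lborel. \<forall>s>- h x. \<exists>d>0. \<forall>a b. a < b \<longrightarrow> a \<le> x \<longrightarrow> x \<le> b \<longrightarrow> b - a < d \<longrightarrow>
    (LINT t:{a..b}|lborel. - h t) < s * (b - a)"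
    using h by (intro AE_small_interval_averages_less) simp
  with AE_small_interval_averages_less[OF h] show ?thesis
  proof eventually_elim
    case (elim x)
    show ?case unfolding has_field_derivative_iff
    proof (rule tendstoI)
      fix e :: real assume "e > 0"
      then obtain d1 d2 where d1: "d1 > 0" "\<And>a b. a < b \<Longrightarrow> a \<le> x \<Longrightarrow> x \<le> b \<Longrightarrow> b - a < d1 \<Longrightarrow>
          (LINT t:{a..b}|lborel. h t) < (h x + e) * (b - a)"
        and d2: "d2 > 0" "\<And>a b. a < b \<Longrightarrow> a \<le> x \<Longrightarrow> x \<le> b \<Longrightarrow> b - a < d2 \<Longrightarrow>
          (LINT t:{a..b}|lborel. - h t) < (- h x + e) * (b - a)"
        using elim(1)[rule_format, of "h x + e"] elim(2)[rule_format, of "- h x + e"] by auto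
      have *: "\<bar>(F b - F a) / (b - a) - h x\<bar> < e"
        if ab: "a < b" "a \<le> x" "x \<le> b" "b - a < min d1 d2" for a b
      proof -
        have "F b - F a < (h x + e) * (b - a)" using d1(2)[of a b] ab F[of a b] by simp
        moreover have "- (F b - F a) < (- h x + e) * (b - a)"
          using d2(2)[of a b] ab F[of a b] by (simp add: set_lebesgue_integral_def)
        ultimately show ?thesis using ab by (simp add: abs_less_iff field_simps)
      qed
      have "dist ((F y - F x) / (y - x)) (h x) < e" if "y \<noteq> x" "dist y x < min d1 d2" for y
      proof (cases "x < y")
        case True
        then show ?thesis using *[of x y] that by (simp add: dist_real_def)
      next
        case False
        have "(F y - F x) / (y - x) = (F x - F y) / (x - y)"
          by (metis minus_diff_eq minus_divide_divide)
        then show ?thesis using *[of y x] False that by (simp add: dist_real_def)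
      qed
      then show "\<forall>\<^sub>F y in at x. dist ((F y - F x) / (y - x)) (h x) < e"
        unfolding eventually_at using d1(1) d2(1) by (intro exI[of _ "min d1 d2"]) auto
    qed
  qed
qed

section \<open>Densities of absolutely continuous monotone functions\<close>

text \<open>
  The families that occur in the definition of absolute continuity, restricted to nondegenerate intervals.
  Nondegeneracy makes families supported in disjoint intervals disjoint as sets of pairs.
\<close>

definition interval_family :: "(real \<times> real) set \<Rightarrow> bool" where
  "interval_family D \<longleftrightarrow> finite D \<and> (\<forall>p\<in>D. fst p < snd p) \<and>
     pairwise (\<lambda>p q. disjnt {fst p<..<snd p} {fst q<..<snd q}) D"

lemma interval_family_finite: "interval_family D \<Longrightarrow> finite D"
  by (simp add: interval_family_def)

lemma interval_family_less: "interval_family D \<Longrightarrow> p \<in> D \<Longrightarrow> fst p < snd p"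
  by (simp add: interval_family_def)

lemma interval_family_disjnt:
  "interval_family D \<Longrightarrow> p \<in> D \<Longrightarrow> q \<in> D \<Longrightarrow> p \<noteq> q \<Longrightarrow> disjnt {fst p<..<snd p} {fst q<..<snd q}"
  by (simp add: interval_family_def pairwise_def)

lemma emeasure_le_if_finite_subfamilies_le:
  assumes D: "countable D" "D \<subseteq> sets M"
    and le: "\<And>\<F>. finite \<F> \<Longrightarrow> \<F> \<subseteq> D \<Longrightarrow> emeasure M (\<Union>\<F>) \<le> e"
  shows "emeasure M (\<Union>D) \<le> e"
proof (cases "D = {}")
  case True
  then show ?thesis by simp
next
  case False
  define f where "f = from_nat_into D"
  have f: "range f = D" using D(1) False unfolding f_def by (rule range_from_nat_into[rotated])
  define A where "A = (\<lambda>n. \<Union>(f ` {..n::nat}))"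
  have sub: "f ` {..n} \<subseteq> D" for n using f by blast
  have "\<Union>(range f) = (\<Union>n. A n)" by (auto simp: A_def)
  then have "\<Union>D = (\<Union>n. A n)" by (simp only: f)
  moreover have "incseq A" by (force simp: A_def incseq_def)
  moreover have "range A \<subseteq> sets M"
  proof safe
    fix n show "A n \<in> sets M" unfolding A_def using sub[of n] D(2) by (intro sets.finite_Union) auto
  qed
  ultimately have "emeasure M (\<Union>D) = (SUP n. emeasure M (A n))"
    by (simp add: SUP_emeasure_incseq)
  also have "\<dots> \<le> e" using le sub by (intro SUP_least) (auto simp: A_def)
  finally show ?thesis .
qed

lemma UN_symmetric_intervals: "(\<Union>k::nat. {- real k..real k}) = UNIV"
proof -
  have "x \<in> (\<Union>k::nat. {- real k..real k})" for x :: real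
  proof -
    obtain k :: nat where "\<bar>x\<bar> \<le> real k" using real_arch_simple by blast
    then have "x \<in> {- real k..real k}" by (simp add: abs_le_iff minus_le_iff)
    then show ?thesis by blast
  qed
  then show ?thesis by blast
qed

text \<open>
  Absolute continuity of \<open>F\<close> makes its Stieltjes measure absolutely continuous: a null set lies in an
  open set of small Lebesgue measure, and inside that open set it is covered by countably many nonoverlapping
  closed intervals. Every finite subfamily of these has small total length and therefore small total
  \<open>F\<close>-increment.
\<close>

lemma interval_measure_null:
  fixes F :: "real \<Rightarrow> real"
  assumes mono: "mono F" and cont: "continuous_on UNIV F"
    and ac: "\<And>e. e > 0 \<Longrightarrow> \<exists>d>0. \<forall>D. interval_family D \<longrightarrow> (\<Sum>(a, b)\<in>D. b - a) < d \<longrightarrow>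
      (\<Sum>(a, b)\<in>D. F b - F a) \<le> e"
    and N: "N \<in> null_sets lborel"
  shows "N \<in> null_sets (interval_measure F)"
proof -
  let ?M = "interval_measure F"
  have N_borel: "N \<in> sets borel" and N_null: "emeasure lborel N = 0" using N by auto
  have Icc: "emeasure ?M {a..b} = ennreal (F b - F a)" if "a \<le> b" for a b
    using mono cont that by (intro emeasure_interval_measure_Icc) (auto simp: mono_def)
  have "emeasure ?M (N \<inter> cbox (- real k) (real k)) = 0" for k
  proof (cases "k = 0")
    case True
    have "emeasure ?M (N \<inter> cbox (- real k) (real k)) \<le> emeasure ?M {0..0}"
      using True by (intro emeasure_mono) auto
    then show ?thesis using Icc[of 0 0] by simp
  next
    case False
    let ?S = "N \<inter> cbox (- real k) (real k)"
    have le_e: "emeasure ?M ?S \<le> ennreal e" if "e > 0" for e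
    proof -
      obtain d where d: "d > 0" and dD: "\<And>D. interval_family D \<Longrightarrow> (\<Sum>(a, b)\<in>D. b - a) < d \<Longrightarrow>
          (\<Sum>(a, b)\<in>D. F b - F a) \<le> e"
        using ac[OF \<open>e > 0\<close>] by blast
      obtain U where U: "open U" "N \<subseteq> U" "emeasure lborel (U - N) < ennreal d"
        using outer_regular_lborel[OF _ d, of N] N_borel by auto
      have "emeasure lborel U = emeasure lborel (U - N)"
        using emeasure_Diff_null_set[OF N, of U] U(1) by simp
      then have U_less: "emeasure lborel U < ennreal d" using U(3) by simp
      \<comment> \<open>With this gauge the covering lemma yields intervals that lie inside \<open>U\<close>.\<close>
      have gauge: "gauge (\<lambda>x. if x \<in> U then U else UNIV)"
        using U(1) by (auto simp: gauge_def)
      obtain \<D> where \<D>: "countable \<D>" "\<Union>\<D> \<subseteq> cbox (- real k) (real k)"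
        "\<And>K. K \<in> \<D> \<Longrightarrow> interior K \<noteq> {} \<and> (\<exists>c d. K = cbox c d)"
        "pairwise (\<lambda>A B. interior A \<inter> interior B = {}) \<D>"
        "\<And>K. K \<in> \<D> \<Longrightarrow> \<exists>x \<in> ?S \<inter> K. K \<subseteq> (if x \<in> U then U else UNIV)"
        "?S \<subseteq> \<Union>\<D>"
        by (rule covering_lemma[OF _ _ gauge, of ?S "- real k" "real k"]) (use False in auto)
      have Kd: "Inf K < Sup K \<and> K = {Inf K..Sup K}" if "K \<in> \<D>" for K
      proof -
        obtain c d where "K = {c..d}" "interior K \<noteq> {}" using \<D>(3)[OF \<open>K \<in> \<D>\<close>] by auto
        moreover from this have "c < d" by simp
        ultimately show ?thesis by simp
      qed
      have KM: "K \<in> sets ?M" if "K \<in> \<D>" for K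
      proof -
        obtain c d where "K = {c..d}" using \<D>(3)[OF \<open>K \<in> \<D>\<close>] by auto
        then show ?thesis by simp
      qed
      have KU: "K \<subseteq> U" if "K \<in> \<D>" for K
        using \<D>(5)[OF that] U(2) by (auto split: if_splits)
      have fin: "emeasure ?M (\<Union>\<F>) \<le> ennreal e" if \<F>: "finite \<F>" "\<F> \<subseteq> \<D>" for \<F>
      proof -
        let ?p = "\<lambda>K. (Inf K, Sup K)"
        have lt: "Inf K < Sup K" if "K \<in> \<F>" for K using Kd \<F>(2) that by blast
        have MK: "emeasure ?M K = ennreal (F (Sup K) - F (Inf K))" if "K \<in> \<F>" for K
        proof -
          have "K = {Inf K..Sup K}" using Kd \<F>(2) that by blast
          then have "emeasure ?M K = emeasure ?M {Inf K..Sup K}" by (rule arg_cong)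
          also have "\<dots> = ennreal (F (Sup K) - F (Inf K))" using lt[OF that] by (intro Icc) simp
          finally show ?thesis .
        qed
        have inj: "inj_on ?p \<F>"
        proof (rule inj_onI)
          fix K L assume "K \<in> \<F>" "L \<in> \<F>" "?p K = ?p L"
          moreover from this have "K = {Inf K..Sup K}" "L = {Inf L..Sup L}" using Kd \<F>(2) by blast+
          ultimately show "K = L" by (metis prod.inject)
        qed
        have int: "interior K = {Inf K<..<Sup K}" if "K \<in> \<F>" for K
        proof -
          have "K = {Inf K..Sup K}" using Kd \<F>(2) that by blast
          then have "interior K = interior {Inf K..Sup K}" by (rule arg_cong)
          then show ?thesis by simp
        qed
        have disj: "disjoint_family_on interior \<F>"
          using \<D>(4) \<F>(2) by (auto simp: disjoint_family_on_def pairwise_def)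
        have fam: "interval_family (?p ` \<F>)"
          unfolding interval_family_def pairwise_image
        proof (intro conjI)
          show "finite (?p ` \<F>)" using \<F>(1) by simp
          show "\<forall>p\<in>?p ` \<F>. fst p < snd p" using lt by auto
          show "pairwise (\<lambda>K L. ?p K \<noteq> ?p L \<longrightarrow>
              disjnt {fst (?p K)<..<snd (?p K)} {fst (?p L)<..<snd (?p L)}) \<F>"
            using disj int by (auto simp: pairwise_def disjnt_def disjoint_family_on_def)
        qed
        have "(\<Sum>(a, b)\<in>?p ` \<F>. b - a) = (\<Sum>K\<in>\<F>. Sup K - Inf K)"
          using inj by (simp add: sum.reindex)
        also have "ennreal \<dots> = (\<Sum>K\<in>\<F>. ennreal (Sup K - Inf K))"
          using lt by (subst sum_ennreal) (auto simp: less_imp_le)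
        also have "\<dots> = (\<Sum>K\<in>\<F>. emeasure lborel (interior K))"
          using lt int by (intro sum.cong) (auto simp: less_imp_le)
        also have "\<dots> = emeasure lborel (\<Union>K\<in>\<F>. interior K)"
          using disj \<F>(1) by (intro sum_emeasure) auto
        also have "\<dots> \<le> emeasure lborel U"
        proof (rule emeasure_mono)
          show "(\<Union>K\<in>\<F>. interior K) \<subseteq> U"
            using KU \<F>(2) interior_subset by (intro UN_least) blast
        qed (use U(1) in auto)
        also note U_less
        finally have "(\<Sum>(a, b)\<in>?p ` \<F>. b - a) < d" by (meson ennreal_leI leD not_le)
        from dD[OF fam this] have sum_le: "(\<Sum>K\<in>\<F>. F (Sup K) - F (Inf K)) \<le> e"
          using inj by (simp add: sum.reindex)
        have "emeasure ?M (\<Union>\<F>) = emeasure ?M (\<Union>K\<in>\<F>. K)" by simp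
        also have "\<dots> \<le> (\<Sum>K\<in>\<F>. emeasure ?M K)"
          using \<F> KM by (intro emeasure_subadditive_finite) auto
        also have "\<dots> = (\<Sum>K\<in>\<F>. ennreal (F (Sup K) - F (Inf K)))"
          using MK by (intro sum.cong) auto
        also have "\<dots> = ennreal (\<Sum>K\<in>\<F>. F (Sup K) - F (Inf K))"
          using lt mono by (subst sum_ennreal) (auto simp: mono_def less_imp_le)
        also have "\<dots> \<le> ennreal e" using sum_le by (rule ennreal_leI)
        finally show ?thesis .
      qed
      have "\<D> \<subseteq> sets ?M" using KM by blast
      then have "emeasure ?M (\<Union>\<D>) \<le> ennreal e" "\<Union>\<D> \<in> sets ?M"
        using emeasure_le_if_finite_subfamilies_le[OF \<D>(1) _ fin] \<D>(1) by (auto intro: sets.countable_Union)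
      then show ?thesis using emeasure_mono[OF \<D>(6), of ?M] by auto
    qed
    have "emeasure ?M ?S \<le> 0"
      by (rule ennreal_le_epsilon) (simp only: add_0_left le_e)
    then show ?thesis by simp
  qed
  then have "(\<Union>k::nat. N \<inter> cbox (- real k) (real k)) \<in> null_sets ?M"
    using N_borel by (intro null_sets_UN) (auto simp: null_sets_def)
  moreover have "(\<Union>k::nat. N \<inter> cbox (- real k) (real k)) = N"
    using UN_symmetric_intervals by (simp flip: Int_UN_distrib)
  ultimately show ?thesis by simp
qed

lemma ex_density_of_absolutely_continuous_mono:
  fixes F :: "real \<Rightarrow> real"
  assumes mono: "mono F" and cont: "continuous_on UNIV F" and bdd: "bounded (range F)"
    and ac: "\<And>e. e > 0 \<Longrightarrow> \<exists>d>0. \<forall>D. interval_family D \<longrightarrow> (\<Sum>(a, b)\<in>D. b - a) < d \<longrightarrow>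
      (\<Sum>(a, b)\<in>D. F b - F a) \<le> e"
  shows "\<exists>g :: real \<Rightarrow> real. integrable lborel g \<and>
    (\<forall>a b. a \<le> b \<longrightarrow> F b - F a = (LINT t:{a..b}|lborel. g t))"
proof -
  let ?M = "interval_measure F"
  have Icc: "emeasure ?M {a..b} = ennreal (F b - F a)" if "a \<le> b" for a b
    using mono cont that by (intro emeasure_interval_measure_Icc) (auto simp: mono_def)
  have "absolutely_continuous lborel ?M"
    unfolding absolutely_continuous_def using interval_measure_null[OF mono cont ac] by blast
  then obtain f where f[measurable]: "f \<in> borel_measurable lborel" and dens: "density lborel f = ?M"
    using sigma_finite_measure.Radon_Nikodym[OF sigma_finite_lborel, of ?M] by auto
  obtain B where B: "\<And>x. \<bar>F x\<bar> \<le> B" using bdd by (auto simp: bounded_iff)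
  have "(\<integral>\<^sup>+x. f x \<partial>lborel) = emeasure ?M UNIV"
    unfolding dens[symmetric] by (simp add: emeasure_density)
  also have "\<dots> = (SUP n::nat. emeasure ?M {- real n..real n})"
  proof (subst SUP_emeasure_incseq)
    show "emeasure ?M UNIV = emeasure ?M (\<Union>n::nat. {- real n..real n})"
      by (simp only: UN_symmetric_intervals)
  qed (auto simp: incseq_def)
  also have "\<dots> \<le> ennreal (2 * B)"
  proof (rule SUP_least)
    fix n :: nat
    have "F (real n) - F (- real n) \<le> 2 * B" using B[of "real n"] B[of "- real n"] by linarith
    then show "emeasure ?M {- real n..real n} \<le> ennreal (2 * B)" by (simp add: Icc ennreal_leI)
  qed
  finally have fin: "(\<integral>\<^sup>+x. f x \<partial>lborel) < \<infinity>" by (simp add: le_less_trans)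
  define g where "g = (\<lambda>x. enn2real (f x))"
  have g[measurable]: "g \<in> borel_measurable lborel" unfolding g_def by measurable
  have ae: "AE x in lborel. f x = ennreal (g x)"
  proof -
    have "AE x in lborel. f x \<noteq> \<infinity>" using fin by (intro nn_integral_noteq_infinite) auto
    then show ?thesis by eventually_elim (simp add: g_def less_top)
  qed
  have g_nn: "0 \<le> g x" for x by (simp add: g_def)
  have "integrable lborel g"
  proof (rule integrableI_nonneg)
    have "(\<integral>\<^sup>+x. ennreal (g x) \<partial>lborel) = (\<integral>\<^sup>+x. f x \<partial>lborel)"
      using ae by (intro nn_integral_cong_AE) auto
    then show "(\<integral>\<^sup>+x. ennreal (g x) \<partial>lborel) < \<infinity>" using fin by simp
  qed (use g_nn in auto)
  moreover have "F b - F a = (LINT t:{a..b}|lborel. g t)" if "a \<le> b" for a b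
  proof -
    have "ennreal (F b - F a) = emeasure (density lborel f) {a..b}" by (simp add: dens Icc that)
    also have "\<dots> = (\<integral>\<^sup>+x. f x * indicator {a..b} x \<partial>lborel)" by (simp add: emeasure_density)
    also have "\<dots> = (\<integral>\<^sup>+x. ennreal (indicator {a..b} x * g x) \<partial>lborel)"
      using ae by (intro nn_integral_cong_AE) (auto split: split_indicator)
    finally have e: "(\<integral>\<^sup>+x. ennreal (indicator {a..b} x * g x) \<partial>lborel) = ennreal (F b - F a)" by simp
    have "(LINT t:{a..b}|lborel. g t) = enn2real (\<integral>\<^sup>+x. ennreal (indicator {a..b} x * g x) \<partial>lborel)"
      unfolding set_lebesgue_integral_def using g_nn by (subst integral_eq_nn_integral) auto
    then show ?thesis using that mono by (simp add: e mono_def)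
  qed
  ultimately show ?thesis by blast
qed

section \<open>Absolutely continuous functions and their variation\<close>

text \<open>
  A monotone map \<open>h\<close> sends nonoverlapping intervals to nonoverlapping intervals, once those that it
  collapses to points are dropped; they contribute nothing to sums of increments. With \<open>h\<close> a truncation this
  moves a family into a given interval, or cuts it at a point.
\<close>

lemma interval_family_push:
  assumes D: "interval_family D" and h: "mono h"
  obtains D' where "interval_family D'" "D' \<subseteq> map_prod h h ` D"
    "\<And>g :: real \<Rightarrow> real \<Rightarrow> real. (\<And>x. g x x = 0) \<Longrightarrow>
      (\<Sum>(a, b)\<in>D'. g a b) = (\<Sum>(a, b)\<in>D. g (h a) (h b))"
proof
  define C where "C = {p \<in> D. h (fst p) < h (snd p)}"
  have fin: "finite D" "finite C" and lt: "\<And>p. p \<in> D \<Longrightarrow> fst p < snd p"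
    using interval_family_finite[OF D] interval_family_less[OF D] by (auto simp: C_def)
  have sep: "h (snd p) \<le> h (fst q) \<or> h (snd q) \<le> h (fst p)" if "p \<in> D" "q \<in> D" "p \<noteq> q" for p q
  proof -
    have "disjnt {fst p<..<snd p} {fst q<..<snd q}"
      using interval_family_disjnt[OF D that] .
    then have "snd p \<le> fst q \<or> snd q \<le> fst p"
      using lt[OF that(1)] lt[OF that(2)]
      by (auto simp: disjnt_def)
    then show ?thesis using h by (auto simp: mono_def)
  qed
  have inj: "inj_on (map_prod h h) C"
  proof (rule inj_onI, rule ccontr)
    fix p q assume pq: "p \<in> C" "q \<in> C" "map_prod h h p = map_prod h h q" "p \<noteq> q"
    then have "h (fst p) = h (fst q)" "h (snd p) = h (snd q)" by (auto simp: map_prod_def case_prod_unfold)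
    then show False using sep[of p q] pq by (auto simp: C_def)
  qed
  show "map_prod h h ` C \<subseteq> map_prod h h ` D" by (auto simp: C_def)
  show "interval_family (map_prod h h ` C)"
    unfolding interval_family_def
  proof (intro conjI)
    show "pairwise (\<lambda>p q. disjnt {fst p<..<snd p} {fst q<..<snd q}) (map_prod h h ` C)"
      unfolding pairwise_image
    proof (intro pairwiseI impI)
      fix p q assume "p \<in> C" "q \<in> C" "p \<noteq> q"
      then have "h (snd p) \<le> h (fst q) \<or> h (snd q) \<le> h (fst p)" using sep by (simp add: C_def)
      then show "disjnt {fst (map_prod h h p)<..<snd (map_prod h h p)}
          {fst (map_prod h h q)<..<snd (map_prod h h q)}"
        by (auto simp: disjnt_def)
    qed
  qed (use fin in \<open>auto simp: C_def\<close>)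
  fix g :: "real \<Rightarrow> real \<Rightarrow> real" assume g: "\<And>x. g x x = 0"
  have "(\<Sum>(a, b)\<in>map_prod h h ` C. g a b) = (\<Sum>(a, b)\<in>C. g (h a) (h b))"
    using inj by (subst sum.reindex) (auto intro!: sum.cong)
  also have "\<dots> = (\<Sum>(a, b)\<in>D. g (h a) (h b))"
  proof (rule sum.mono_neutral_left)
    show "\<forall>p\<in>D - C. (case p of (a, b) \<Rightarrow> g (h a) (h b)) = 0"
    proof
      fix p assume p: "p \<in> D - C"
      then have "h (fst p) \<le> h (snd p)" using lt[of p] h by (auto simp: mono_def less_imp_le)
      then have "h (fst p) = h (snd p)" using p by (auto simp: C_def)
      then show "(case p of (a, b) \<Rightarrow> g (h a) (h b)) = 0" using g by (simp add: case_prod_unfold)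
    qed
  qed (use fin in \<open>auto simp: C_def\<close>)
  finally show "(\<Sum>(a, b)\<in>map_prod h h ` C. g a b) = (\<Sum>(a, b)\<in>D. g (h a) (h b))" .
qed

lemma interval_family_length_le:
  assumes D: "interval_family D" "D \<subseteq> {a..b} \<times> {a..b}" and "a \<le> b"
  shows "(\<Sum>(c, d)\<in>D. d - c) \<le> b - a"
proof -
  have fin: "finite D" and lt: "\<And>p. p \<in> D \<Longrightarrow> fst p < snd p"
    using interval_family_finite[OF D(1)] interval_family_less[OF D(1)] by auto
  have disj: "disjoint_family_on (\<lambda>p. {fst p<..<snd p}) D"
    using interval_family_disjnt[OF D(1)] by (simp add: disjoint_family_on_def disjnt_def)
  have "ennreal (\<Sum>p\<in>D. snd p - fst p) = (\<Sum>p\<in>D. ennreal (snd p - fst p))"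
    using lt by (subst sum_ennreal) (auto simp: less_imp_le)
  also have "\<dots> = (\<Sum>p\<in>D. emeasure lborel {fst p<..<snd p})"
    using lt by (intro sum.cong) (auto simp: less_imp_le)
  also have "\<dots> = emeasure lborel (\<Union>p\<in>D. {fst p<..<snd p})"
    using disj fin by (intro sum_emeasure) auto
  also have "\<dots> \<le> emeasure lborel {a..b}"
  proof (rule emeasure_mono)
    show "(\<Union>p\<in>D. {fst p<..<snd p}) \<subseteq> {a..b}"
    proof (rule UN_least)
      fix p assume "p \<in> D"
      then have "a \<le> fst p" "snd p \<le> b" using D(2) by auto
      then show "{fst p<..<snd p} \<subseteq> {a..b}" by auto
    qed
  qed simp
  also have "\<dots> = ennreal (b - a)" using \<open>a \<le> b\<close> by simp
  finally show ?thesis using \<open>a \<le> b\<close> by (simp add: case_prod_unfold)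
qed

lemma interval_family_UN:
  assumes E: "interval_family E"
    and D: "\<And>p. p \<in> E \<Longrightarrow> interval_family (D p)" "\<And>p. p \<in> E \<Longrightarrow> D p \<subseteq> {fst p..snd p} \<times> {fst p..snd p}"
  shows "interval_family (\<Union>p\<in>E. D p)"
    and "(\<Sum>x\<in>(\<Union>p\<in>E. D p). g x) = (\<Sum>p\<in>E. \<Sum>x\<in>D p. (g x :: real))"
proof -
  have sep: "disjnt {fst x<..<snd x} {fst y<..<snd y}"
    if pq: "p \<in> E" "q \<in> E" "p \<noteq> q" "x \<in> D p" "y \<in> D q" for p q x y
  proof -
    have "disjnt {fst p<..<snd p} {fst q<..<snd q}"
      using interval_family_disjnt[OF E pq(1-3)] .
    moreover have "{fst x<..<snd x} \<subseteq> {fst p<..<snd p}" "{fst y<..<snd y} \<subseteq> {fst q<..<snd q}"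
      using subsetD[OF D(2)[OF pq(1)] pq(4)] subsetD[OF D(2)[OF pq(2)] pq(5)]
      by (auto simp: mem_Times_iff)
    ultimately show ?thesis by (meson disjnt_subset1 disjnt_subset2)
  qed
  have lt: "fst x < snd x" if "p \<in> E" "x \<in> D p" for p x
    using interval_family_less[OF D(1)[OF that(1)] that(2)] .
  show "interval_family (\<Union>p\<in>E. D p)"
    unfolding interval_family_def
  proof (intro conjI)
    show "finite (\<Union>p\<in>E. D p)" using E D(1) by (auto simp: interval_family_def)
    show "\<forall>x\<in>\<Union>p\<in>E. D p. fst x < snd x" using lt by blast
    show "pairwise (\<lambda>p q. disjnt {fst p<..<snd p} {fst q<..<snd q}) (\<Union>p\<in>E. D p)"
    proof (rule pairwiseI)
      fix x y assume xy: "x \<in> (\<Union>p\<in>E. D p)" "y \<in> (\<Union>p\<in>E. D p)" "x \<noteq> y"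
      then obtain p q where pq: "p \<in> E" "q \<in> E" "x \<in> D p" "y \<in> D q" by blast
      show "disjnt {fst x<..<snd x} {fst y<..<snd y}"
      proof (cases "p = q")
        case True
        then show ?thesis using interval_family_disjnt[OF D(1)[OF pq(1)] pq(3)] pq(4) xy(3) by simp
      next
        case False
        then show ?thesis using sep pq by blast
      qed
    qed
  qed
  show "(\<Sum>x\<in>(\<Union>p\<in>E. D p). g x) = (\<Sum>p\<in>E. \<Sum>x\<in>D p. g x)"
  proof (rule sum.UNION_disjoint)
    show "\<forall>p\<in>E. \<forall>q\<in>E. p \<noteq> q \<longrightarrow> D p \<inter> D q = {}"
    proof (intro ballI impI equals0I)
      fix p q x assume "p \<in> E" "q \<in> E" "p \<noteq> q" "x \<in> D p \<inter> D q"
      then have "disjnt {fst x<..<snd x} {fst x<..<snd x}" "fst x < snd x"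
        using sep[of p q x x] lt[of p x] by auto
      then show False by (simp add: disjnt_def)
    qed
  qed (use E D(1) in \<open>auto simp: interval_family_def\<close>)
qed

text \<open>
  The condition that defines \<open>abs_cont_curve\<close>, for real functions on the whole line; a curve on the unit
  interval is extended by constants to fit it.
\<close>

definition AC :: "(real \<Rightarrow> real) \<Rightarrow> bool" where
  "AC f \<longleftrightarrow> (\<forall>e>0. \<exists>d>0. \<forall>D. interval_family D \<longrightarrow> (\<Sum>(a, b)\<in>D. b - a) < d \<longrightarrow>
     (\<Sum>(a, b)\<in>D. \<bar>f b - f a\<bar>) < e)"

lemma ACD:
  assumes "AC f" "e > 0"
  obtains d where "d > 0"
    "\<And>D. interval_family D \<Longrightarrow> (\<Sum>(a, b)\<in>D. b - a) < d \<Longrightarrow> (\<Sum>(a, b)\<in>D. \<bar>f b - f a\<bar>) < e"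
  using assms unfolding AC_def by blast

text \<open>
  Cutting every interval of a family at \<open>c\<close> does not decrease the sum of the increments, by the triangle
  inequality. This is the subadditivity of the variation.
\<close>

lemma interval_family_cut:
  fixes f :: "real \<Rightarrow> real"
  assumes "interval_family D"
  shows "\<exists>D1 D2. interval_family D1 \<and> D1 \<subseteq> {..c} \<times> {..c} \<and>
    interval_family D2 \<and> D2 \<subseteq> {c..} \<times> {c..} \<and>
    (\<forall>b\<ge>c. D \<subseteq> {..b} \<times> {..b} \<longrightarrow> D2 \<subseteq> {c..b} \<times> {c..b}) \<and>
    (\<Sum>(a, b)\<in>D. \<bar>f b - f a\<bar>) \<le> (\<Sum>(a, b)\<in>D1. \<bar>f b - f a\<bar>) + (\<Sum>(a, b)\<in>D2. \<bar>f b - f a\<bar>)"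
proof -
  have m: "mono (min c)" "mono (max c)" by (auto simp: mono_def)
  obtain D1 where D1: "interval_family D1" "D1 \<subseteq> map_prod (min c) (min c) ` D"
    "\<And>g :: real \<Rightarrow> real \<Rightarrow> real. (\<And>x. g x x = 0) \<Longrightarrow>
      (\<Sum>(a, b)\<in>D1. g a b) = (\<Sum>(a, b)\<in>D. g (min c a) (min c b))"
    using interval_family_push[OF assms m(1)] by blast
  obtain D2 where D2: "interval_family D2" "D2 \<subseteq> map_prod (max c) (max c) ` D"
    "\<And>g :: real \<Rightarrow> real \<Rightarrow> real. (\<And>x. g x x = 0) \<Longrightarrow>
      (\<Sum>(a, b)\<in>D2. g a b) = (\<Sum>(a, b)\<in>D. g (max c a) (max c b))"
    using interval_family_push[OF assms m(2)] by blast
  show ?thesis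
  proof (intro exI conjI allI impI)
    show "interval_family D1" "interval_family D2" by fact+
    show "D1 \<subseteq> {..c} \<times> {..c}" using D1(2) by auto
    show "D2 \<subseteq> {c..} \<times> {c..}" using D2(2) by auto
    show "D2 \<subseteq> {c..b} \<times> {c..b}" if "b \<ge> c" "D \<subseteq> {..b} \<times> {..b}" for b
    proof -
      have "map_prod (max c) (max c) ` D \<subseteq> {c..b} \<times> {c..b}" using that by auto
      then show ?thesis using D2(2) by blast
    qed
    have "(\<Sum>(a, b)\<in>D. \<bar>f b - f a\<bar>) \<le>
      (\<Sum>(a, b)\<in>D. \<bar>f (min c b) - f (min c a)\<bar> + \<bar>f (max c b) - f (max c a)\<bar>)"
    proof (rule sum_mono)
      fix p assume "p \<in> D"
      then show "(case p of (a, b) \<Rightarrow> \<bar>f b - f a\<bar>) \<le>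
        (case p of (a, b) \<Rightarrow> \<bar>f (min c b) - f (min c a)\<bar> + \<bar>f (max c b) - f (max c a)\<bar>)"
        by (cases p) (auto simp: min_def max_def)
    qed
    also have "\<dots> = (\<Sum>(a, b)\<in>D1. \<bar>f b - f a\<bar>) + (\<Sum>(a, b)\<in>D2. \<bar>f b - f a\<bar>)"
      using D1(3)[of "\<lambda>a b. \<bar>f b - f a\<bar>"] D2(3)[of "\<lambda>a b. \<bar>f b - f a\<bar>"]
      by (simp add: case_prod_unfold sum.distrib)
    finally show "(\<Sum>(a, b)\<in>D. \<bar>f b - f a\<bar>) \<le> (\<Sum>(a, b)\<in>D1. \<bar>f b - f a\<bar>) + (\<Sum>(a, b)\<in>D2. \<bar>f b - f a\<bar>)" .
  qed
qed

text \<open>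
  Over an interval shorter than the \<open>d\<close> that belongs to the tolerance \<open>1\<close>, the variation is at most \<open>1\<close>. Cutting
  the line at the multiples of such a length, all but finitely many pieces lie where \<open>f\<close> is constant.
\<close>

lemma AC_bounded_variation:
  assumes f: "AC f" and left: "\<And>x. x \<le> 0 \<Longrightarrow> f x = f 0" and right: "\<And>x. 1 \<le> x \<Longrightarrow> f x = f 1"
  shows "\<exists>B. \<forall>D. interval_family D \<longrightarrow> (\<Sum>(a, b)\<in>D. \<bar>f b - f a\<bar>) \<le> B"
proof -
  obtain d where d: "d > 0"
    "\<And>D. interval_family D \<Longrightarrow> (\<Sum>(a, b)\<in>D. b - a) < d \<Longrightarrow> (\<Sum>(a, b)\<in>D. \<bar>f b - f a\<bar>) < 1"
    using ACD[OF f, of 1] by auto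
  define \<eta> where "\<eta> = d / 2"
  have \<eta>: "0 < \<eta>" "\<eta> < d" using d(1) by (auto simp: \<eta>_def)
  have *: "(\<Sum>(a, b)\<in>D. \<bar>f b - f a\<bar>) \<le> real n"
    if "interval_family D" "D \<subseteq> {..real n * \<eta>} \<times> {..real n * \<eta>}" for n :: nat and D :: "(real \<times> real) set"
    using that
  proof (induct n arbitrary: D)
    case (0 D)
    have "(\<Sum>(a, b)\<in>D. \<bar>f b - f a\<bar>) = 0"
    proof (intro sum.neutral ballI)
      fix p assume "p \<in> D"
      then have "fst p \<le> 0" "snd p \<le> 0" using subsetD[OF 0(2)] by (auto simp: mem_Times_iff)
      then have "f (fst p) = f (snd p)" using left[of "fst p"] left[of "snd p"] by simp
      then show "(case p of (a, b) \<Rightarrow> \<bar>f b - f a\<bar>) = 0" by (simp add: case_prod_unfold)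
    qed
    then show ?case by simp
  next
    case (Suc n D)
    obtain D1 D2 where D1: "interval_family D1" "D1 \<subseteq> {..n * \<eta>} \<times> {..n * \<eta>}"
      and D2: "interval_family D2" "D2 \<subseteq> {n * \<eta>..} \<times> {n * \<eta>..}" "\<forall>b\<ge>n * \<eta>. D \<subseteq> {..b} \<times> {..b} \<longrightarrow> D2 \<subseteq> {n * \<eta>..b} \<times> {n * \<eta>..b}"
      and le: "(\<Sum>(a, b)\<in>D. \<bar>f b - f a\<bar>) \<le> (\<Sum>(a, b)\<in>D1. \<bar>f b - f a\<bar>) + (\<Sum>(a, b)\<in>D2. \<bar>f b - f a\<bar>)"
      using interval_family_cut[OF Suc(2), of "n * \<eta>" f] by blast
    have step: "real (Suc n) * \<eta> = n * \<eta> + \<eta>" by (simp add: algebra_simps)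
    have "D2 \<subseteq> {n * \<eta>..Suc n * \<eta>} \<times> {n * \<eta>..Suc n * \<eta>}"
      using Suc(3) \<eta> by (intro D2(3)[rule_format]) (auto simp: step)
    from interval_family_length_le[OF D2(1) this] have "(\<Sum>(a, b)\<in>D2. b - a) \<le> \<eta>"
      using \<eta>(1) unfolding step by simp
    then have "(\<Sum>(a, b)\<in>D2. \<bar>f b - f a\<bar>) < 1" using \<eta> D2(1) by (intro d(2)) auto
    with le Suc(1)[OF D1] show ?case by simp
  qed
  obtain n :: nat where n: "1 \<le> n * \<eta>"
    using reals_Archimedean3[OF \<eta>(1)] by (metis less_imp_le)
  have "(\<Sum>(a, b)\<in>D. \<bar>f b - f a\<bar>) \<le> real n" if D: "interval_family D" for D
  proof -
    obtain D1 D2 where D1: "interval_family D1" "D1 \<subseteq> {..n * \<eta>} \<times> {..n * \<eta>}"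
      and D2: "interval_family D2" "D2 \<subseteq> {n * \<eta>..} \<times> {n * \<eta>..}" "\<forall>b\<ge>n * \<eta>. D \<subseteq> {..b} \<times> {..b} \<longrightarrow> D2 \<subseteq> {n * \<eta>..b} \<times> {n * \<eta>..b}"
      and le: "(\<Sum>(a, b)\<in>D. \<bar>f b - f a\<bar>) \<le> (\<Sum>(a, b)\<in>D1. \<bar>f b - f a\<bar>) + (\<Sum>(a, b)\<in>D2. \<bar>f b - f a\<bar>)"
      using interval_family_cut[OF D, of "n * \<eta>" f] by blast
    have "(\<Sum>(a, b)\<in>D2. \<bar>f b - f a\<bar>) = 0"
    proof (intro sum.neutral ballI)
      fix p assume "p \<in> D2"
      then have "1 \<le> fst p" "1 \<le> snd p" using D2(2) n by (auto intro: order_trans)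
      then have "f (fst p) = f (snd p)" using right[of "fst p"] right[of "snd p"] by simp
      then show "(case p of (a, b) \<Rightarrow> \<bar>f b - f a\<bar>) = 0" by (simp add: case_prod_unfold)
    qed
    with le *[OF D1] show ?thesis by simp
  qed
  then show ?thesis by blast
qed

definition variation_upto :: "(real \<Rightarrow> real) \<Rightarrow> real \<Rightarrow> real" where
  "variation_upto f t =
     (SUP D\<in>{D. interval_family D \<and> D \<subseteq> {..t} \<times> {..t}}. \<Sum>(a, b)\<in>D. \<bar>f b - f a\<bar>)"

context
  fixes f :: "real \<Rightarrow> real" and B :: real
  assumes B: "\<And>D. interval_family D \<Longrightarrow> (\<Sum>(a, b)\<in>D. \<bar>f b - f a\<bar>) \<le> B"
begin

lemma sum_le_variation_upto:
  assumes "interval_family D" "D \<subseteq> {..t} \<times> {..t}"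
  shows "(\<Sum>(a, b)\<in>D. \<bar>f b - f a\<bar>) \<le> variation_upto f t"
  unfolding variation_upto_def using assms B
  by (intro cSUP_upper bdd_aboveI2[where M = B]) auto

lemma variation_upto_le:
  assumes "\<And>D. interval_family D \<Longrightarrow> D \<subseteq> {..t} \<times> {..t} \<Longrightarrow> (\<Sum>(a, b)\<in>D. \<bar>f b - f a\<bar>) \<le> c"
  shows "variation_upto f t \<le> c"
proof -
  have "interval_family {}" by (simp add: interval_family_def)
  then show ?thesis unfolding variation_upto_def using assms by (intro cSUP_least) auto
qed

lemma variation_upto_bounds: "0 \<le> variation_upto f t" "variation_upto f t \<le> B"
  using sum_le_variation_upto[of "{}" t] variation_upto_le[of t B] B
  by (auto simp: interval_family_def)

text \<open>
  A family of intervals to the left of \<open>s\<close> may be extended by the interval from \<open>s\<close> to \<open>t\<close>. Consequently both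
  the variation and its sum with \<open>f\<close> are monotone.
\<close>

lemma abs_diff_le_variation_upto_diff:
  assumes "s \<le> t"
  shows "\<bar>f t - f s\<bar> \<le> variation_upto f t - variation_upto f s"
proof (cases "s = t")
  case False
  with assms have "s < t" by simp
  have "variation_upto f s \<le> variation_upto f t - \<bar>f t - f s\<bar>"
  proof (rule variation_upto_le)
    fix D assume D: "interval_family D" "D \<subseteq> {..s} \<times> {..s}"
    have new: "(s, t) \<notin> D" using D(2) \<open>s < t\<close> by auto
    have "disjnt {s<..<t} {a<..<b}" if "(a, b) \<in> D" for a b
      using D(2) that by (auto simp: disjnt_def)
    then have "interval_family (insert (s, t) D)"
      using D(1) \<open>s < t\<close>
      by (auto simp: interval_family_def pairwise_insert disjnt_sym)
    moreover have "insert (s, t) D \<subseteq> {..t} \<times> {..t}" using D(2) \<open>s < t\<close> by auto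
    ultimately have "(\<Sum>(a, b)\<in>insert (s, t) D. \<bar>f b - f a\<bar>) \<le> variation_upto f t"
      by (rule sum_le_variation_upto)
    then show "(\<Sum>(a, b)\<in>D. \<bar>f b - f a\<bar>) \<le> variation_upto f t - \<bar>f t - f s\<bar>"
      using new D(1) by (simp add: interval_family_def)
  qed
  then show ?thesis by simp
qed simp

lemma ex_family_variation_upto_diff:
  assumes "s \<le> t" "e > 0"
  shows "\<exists>D. interval_family D \<and> D \<subseteq> {s..t} \<times> {s..t} \<and>
    variation_upto f t - variation_upto f s \<le> (\<Sum>(a, b)\<in>D. \<bar>f b - f a\<bar>) + e"
proof (rule ccontr)
  assume neg: "\<not> ?thesis"
  have "variation_upto f t \<le> variation_upto f t - e"
  proof (rule variation_upto_le)
    fix D assume D: "interval_family D" "D \<subseteq> {..t} \<times> {..t}"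
    obtain D1 D2 where D1: "interval_family D1" "D1 \<subseteq> {..s} \<times> {..s}"
      and D2: "interval_family D2" "\<forall>b\<ge>s. D \<subseteq> {..b} \<times> {..b} \<longrightarrow> D2 \<subseteq> {s..b} \<times> {s..b}"
      and le: "(\<Sum>(a, b)\<in>D. \<bar>f b - f a\<bar>) \<le> (\<Sum>(a, b)\<in>D1. \<bar>f b - f a\<bar>) + (\<Sum>(a, b)\<in>D2. \<bar>f b - f a\<bar>)"
      using interval_family_cut[OF D(1), of s f] by blast
    have "D2 \<subseteq> {s..t} \<times> {s..t}" using D2(2) assms(1) D(2) by blast
    with neg D2(1) have "\<not> variation_upto f t - variation_upto f s \<le> (\<Sum>(a, b)\<in>D2. \<bar>f b - f a\<bar>) + e"
      by blast
    with le sum_le_variation_upto[OF D1]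
    show "(\<Sum>(a, b)\<in>D. \<bar>f b - f a\<bar>) \<le> variation_upto f t - e" by simp
  qed
  with \<open>e > 0\<close> show False by simp
qed

text \<open>
  The increment of the variation over each interval of \<open>E\<close> is almost attained by a family inside that interval.
  The union of these families is again a family, no longer than \<open>E\<close>, to which the absolute continuity of \<open>f\<close>
  applies. The error \<open>\<eta>\<close> per interval is chosen to add up to at most half of the tolerance.
\<close>

lemma AC_variation_upto:
  assumes f: "AC f"
  shows "AC (variation_upto f)"
  unfolding AC_def
proof (intro allI impI)
  fix e :: real assume "e > 0"
  then obtain d where d: "d > 0"
    "\<And>D. interval_family D \<Longrightarrow> (\<Sum>(a, b)\<in>D. b - a) < d \<Longrightarrow> (\<Sum>(a, b)\<in>D. \<bar>f b - f a\<bar>) < e / 2"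
    using ACD[OF f, of "e / 2"] by auto
  have "(\<Sum>(a, b)\<in>E. \<bar>variation_upto f b - variation_upto f a\<bar>) < e"
    if E: "interval_family E" and small: "(\<Sum>(a, b)\<in>E. b - a) < d" for E
  proof -
    \<comment> \<open>The added \<open>1\<close> keeps the quotient meaningful for the empty family.\<close>
    define \<eta> where "\<eta> = e / (2 * (card E + 1))"
    have \<eta>: "\<eta> > 0" "card E * \<eta> \<le> e / 2" using \<open>e > 0\<close> by (auto simp: \<eta>_def field_simps)
    have lt: "fst p \<le> snd p" if "p \<in> E" for p using E that by (auto simp: interval_family_def)
    have "\<exists>D. interval_family D \<and> D \<subseteq> {fst p..snd p} \<times> {fst p..snd p} \<and>
      variation_upto f (snd p) - variation_upto f (fst p) \<le> (\<Sum>(a, b)\<in>D. \<bar>f b - f a\<bar>) + \<eta>"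
      if "p \<in> E" for p using ex_family_variation_upto_diff[OF lt[OF that] \<eta>(1)] .
    then obtain D where D: "\<And>p. p \<in> E \<Longrightarrow> interval_family (D p)"
      "\<And>p. p \<in> E \<Longrightarrow> D p \<subseteq> {fst p..snd p} \<times> {fst p..snd p}"
      "\<And>p. p \<in> E \<Longrightarrow> variation_upto f (snd p) - variation_upto f (fst p) \<le> (\<Sum>(a, b)\<in>D p. \<bar>f b - f a\<bar>) + \<eta>"
      by metis
    note U = interval_family_UN[OF E D(1,2)]
    have "(\<Sum>(a, b)\<in>(\<Union>p\<in>E. D p). b - a) = (\<Sum>p\<in>E. \<Sum>(a, b)\<in>D p. b - a)"
      by (rule U(2))
    also have "\<dots> \<le> (\<Sum>p\<in>E. snd p - fst p)"
      using interval_family_length_le[OF D(1,2) lt] by (intro sum_mono) auto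
    also have "\<dots> < d" using small by (simp add: case_prod_unfold)
    finally have "(\<Sum>(a, b)\<in>(\<Union>p\<in>E. D p). \<bar>f b - f a\<bar>) < e / 2" using U(1) by (intro d(2))
    then have *: "(\<Sum>p\<in>E. \<Sum>(a, b)\<in>D p. \<bar>f b - f a\<bar>) < e / 2"
      using U(2)[of "\<lambda>(a, b). \<bar>f b - f a\<bar>"] by simp
    have "(\<Sum>(a, b)\<in>E. \<bar>variation_upto f b - variation_upto f a\<bar>) =
        (\<Sum>p\<in>E. \<bar>variation_upto f (snd p) - variation_upto f (fst p)\<bar>)"
      by (simp add: case_prod_unfold)
    also have "\<dots> \<le> (\<Sum>p\<in>E. (\<Sum>(a, b)\<in>D p. \<bar>f b - f a\<bar>) + \<eta>)"
    proof (rule sum_mono)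
      fix p assume "p \<in> E"
      then show "\<bar>variation_upto f (snd p) - variation_upto f (fst p)\<bar> \<le> (\<Sum>(a, b)\<in>D p. \<bar>f b - f a\<bar>) + \<eta>"
        using D(3)[of p] abs_diff_le_variation_upto_diff[OF lt, of p] by linarith
    qed
    also have "\<dots> = (\<Sum>p\<in>E. \<Sum>(a, b)\<in>D p. \<bar>f b - f a\<bar>) + card E * \<eta>" by (simp add: sum.distrib)
    also have "\<dots> < e" using * \<eta>(2) by linarith
    finally show ?thesis .
  qed
  with d(1) show "\<exists>d>0. \<forall>D. interval_family D \<longrightarrow> (\<Sum>(a, b)\<in>D. b - a) < d \<longrightarrow>
     (\<Sum>(a, b)\<in>D. \<bar>variation_upto f b - variation_upto f a\<bar>) < e" by blast
qed

end

lemma AC_imp_continuous_on: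
  assumes "AC f"
  shows "continuous_on UNIV f"
  unfolding continuous_on_iff
proof (intro ballI allI impI)
  fix x e :: real assume "e > 0"
  then obtain d where d: "d > 0"
    "\<And>D. interval_family D \<Longrightarrow> (\<Sum>(a, b)\<in>D. b - a) < d \<Longrightarrow> (\<Sum>(a, b)\<in>D. \<bar>f b - f a\<bar>) < e"
    using ACD[OF assms] by blast
  have "dist (f y) (f x) < e" if "dist y x < d" for y
    using d(2)[of "{(x, y)}"] d(2)[of "{(y, x)}"] that \<open>e > 0\<close>
    by (cases x y rule: linorder_cases) (auto simp: interval_family_def dist_real_def abs_minus_commute)
  with d(1) show "\<exists>d>0. \<forall>y\<in>UNIV. dist y x < d \<longrightarrow> dist (f y) (f x) < e" by blast
qed

lemma AC_add:
  assumes "AC f" "AC g"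
  shows "AC (\<lambda>x. f x + g x)"
  unfolding AC_def
proof (intro allI impI)
  fix e :: real assume "e > 0"
  then have e2: "e / 2 > 0" by simp
  obtain d1 where d1: "d1 > 0"
    "\<And>D. interval_family D \<Longrightarrow> (\<Sum>(a, b)\<in>D. b - a) < d1 \<Longrightarrow> (\<Sum>(a, b)\<in>D. \<bar>f b - f a\<bar>) < e / 2"
    using ACD[OF assms(1) e2] by blast
  obtain d2 where d2: "d2 > 0"
    "\<And>D. interval_family D \<Longrightarrow> (\<Sum>(a, b)\<in>D. b - a) < d2 \<Longrightarrow> (\<Sum>(a, b)\<in>D. \<bar>g b - g a\<bar>) < e / 2"
    using ACD[OF assms(2) e2] by blast
  have "(\<Sum>(a, b)\<in>D. \<bar>f b + g b - (f a + g a)\<bar>) < e"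
    if "interval_family D" "(\<Sum>(a, b)\<in>D. b - a) < min d1 d2" for D
  proof -
    have "(\<Sum>(a, b)\<in>D. \<bar>f b + g b - (f a + g a)\<bar>) \<le>
      (\<Sum>(a, b)\<in>D. \<bar>f b - f a\<bar>) + (\<Sum>(a, b)\<in>D. \<bar>g b - g a\<bar>)"
      unfolding sum.distrib[symmetric] by (intro sum_mono) auto
    with d1(2)[OF that(1)] d2(2)[OF that(1)] that(2) show ?thesis by simp
  qed
  with d1(1) d2(1) show "\<exists>d>0. \<forall>D. interval_family D \<longrightarrow> (\<Sum>(a, b)\<in>D. b - a) < d \<longrightarrow>
    (\<Sum>(a, b)\<in>D. \<bar>f b + g b - (f a + g a)\<bar>) < e"
    by (intro exI[of _ "min d1 d2"]) auto
qed

lemma AC_mono_ex_density: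
  assumes "AC f" "mono f" "bounded (range f)"
  shows "\<exists>g :: real \<Rightarrow> real. integrable lborel g \<and>
    (\<forall>a b. a \<le> b \<longrightarrow> f b - f a = (LINT t:{a..b}|lborel. g t))"
proof (rule ex_density_of_absolutely_continuous_mono[OF assms(2) AC_imp_continuous_on[OF assms(1)] assms(3)])
  fix e :: real assume "e > 0"
  then obtain d where d: "d > 0"
    "\<And>D. interval_family D \<Longrightarrow> (\<Sum>(a, b)\<in>D. b - a) < d \<Longrightarrow> (\<Sum>(a, b)\<in>D. \<bar>f b - f a\<bar>) < e"
    using ACD[OF assms(1)] by blast
  have "(\<Sum>(a, b)\<in>D. f b - f a) \<le> e" if "interval_family D" "(\<Sum>(a, b)\<in>D. b - a) < d" for D
  proof -
    have "(\<Sum>(a, b)\<in>D. f b - f a) \<le> (\<Sum>(a, b)\<in>D. \<bar>f b - f a\<bar>)" by (intro sum_mono) auto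
    with d(2)[OF that] show ?thesis by simp
  qed
  with d(1) show "\<exists>d>0. \<forall>D. interval_family D \<longrightarrow> (\<Sum>(a, b)\<in>D. b - a) < d \<longrightarrow>
    (\<Sum>(a, b)\<in>D. f b - f a) \<le> e" by blast
qed

text \<open>
  Jordan decomposition: \<open>f\<close> is the difference of the monotone functions \<open>variation_upto f + f\<close> and \<open>variation_upto f\<close>, both
  absolutely continuous and bounded.
\<close>

theorem AC_ex_density:
  assumes f: "AC f" and left: "\<And>x. x \<le> 0 \<Longrightarrow> f x = f 0" and right: "\<And>x. 1 \<le> x \<Longrightarrow> f x = f 1"
  shows "\<exists>g :: real \<Rightarrow> real. integrable lborel g \<and>
    (\<forall>a b. a \<le> b \<longrightarrow> f b - f a = (LINT t:{a..b}|lborel. g t))"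
proof -
  obtain B where B: "\<And>D. interval_family D \<Longrightarrow> (\<Sum>(a, b)\<in>D. \<bar>f b - f a\<bar>) \<le> B"
    using AC_bounded_variation[OF assms] by blast
  let ?V = "variation_upto f"
  have V: "AC ?V" using AC_variation_upto[OF B f] by blast
  have incr: "\<bar>f t - f s\<bar> \<le> ?V t - ?V s" if "s \<le> t" for s t
    using abs_diff_le_variation_upto_diff[OF B that] by blast
  have V_bd: "0 \<le> ?V t" "?V t \<le> B" for t using variation_upto_bounds[OF B, of t] by auto
  have f_bd: "\<bar>f t - f 0\<bar> \<le> B" for t
    using incr[of 0 t] incr[of t 0] V_bd[of t] V_bd[of 0] by (cases "0 \<le> t") auto
  have V_mono: "mono ?V"
  proof (rule monoI)
    show "?V s \<le> ?V t" if "s \<le> t" for s t using incr[OF that] by simp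
  qed
  have "bounded (range ?V)" unfolding bounded_iff using V_bd by (intro exI[of _ B]) auto
  from AC_mono_ex_density[OF V V_mono this] obtain g1 where g1: "integrable lborel g1"
    "\<And>a b. a \<le> b \<Longrightarrow> ?V b - ?V a = (LINT t:{a..b}|lborel. g1 t)" by blast
  have Vf_mono: "mono (\<lambda>x. ?V x + f x)"
  proof (rule monoI)
    show "?V s + f s \<le> ?V t + f t" if "s \<le> t" for s t using incr[OF that] by simp
  qed
  have "\<bar>?V x + f x\<bar> \<le> 2 * B + \<bar>f 0\<bar>" for x using V_bd[of x] f_bd[of x] by simp
  then have "bounded (range (\<lambda>x. ?V x + f x))" unfolding bounded_iff by auto
  from AC_mono_ex_density[OF AC_add[OF V f] Vf_mono this] obtain g2 where g2: "integrable lborel g2"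
    "\<And>a b. a \<le> b \<Longrightarrow> ?V b + f b - (?V a + f a) = (LINT t:{a..b}|lborel. g2 t)" by blast
  have "f b - f a = (LINT t:{a..b}|lborel. g2 t - g1 t)" if "a \<le> b" for a b
  proof -
    have "set_integrable lborel {a..b} g1" "set_integrable lborel {a..b} g2"
      unfolding set_integrable_def using g1(1) g2(1) by (intro integrable_mult_indicator; simp)+
    then have "(LINT t:{a..b}|lborel. g2 t - g1 t) = (LINT t:{a..b}|lborel. g2 t) - (LINT t:{a..b}|lborel. g1 t)"
      by (intro set_integral_diff(2))
    then show ?thesis using g1(2)[OF that] g2(2)[OF that] by simp
  qed
  then show ?thesis using g1(1) g2(1) by (intro exI[of _ "\<lambda>t. g2 t - g1 t"]) auto
qed

section \<open>Derivatives of absolutely continuous curves\<close>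

definition clamp01 :: "real \<Rightarrow> real" where
  "clamp01 t = max 0 (min 1 t)"

lemma clamp01_simps [simp]:
  "t \<le> 0 \<Longrightarrow> clamp01 t = 0" "1 \<le> t \<Longrightarrow> clamp01 t = 1" "0 \<le> t \<Longrightarrow> t \<le> 1 \<Longrightarrow> clamp01 t = t"
  by (auto simp: clamp01_def)

lemma clamp01_bounds [simp]: "0 \<le> clamp01 t" "clamp01 t \<le> 1"
  by (auto simp: clamp01_def)

lemma abs_cont_curve_imp_AC_component:
  fixes \<alpha> :: "real \<Rightarrow> real ^ 'n"
  assumes \<alpha>: "abs_cont_curve \<alpha>"
  shows "AC (\<lambda>t. \<alpha> (clamp01 t) $ i)"
  unfolding AC_def
proof (intro allI impI)
  fix e :: real assume "e > 0"
  then obtain d where d: "d > 0" "\<And>D :: (real \<times> real) set. finite D \<Longrightarrow>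
      (\<forall>(a, b)\<in>D. 0 \<le> a \<and> a \<le> b \<and> b \<le> 1) \<Longrightarrow>
      pairwise (\<lambda>(a, b) (c, d). disjnt {a<..<b} {c<..<d}) D \<Longrightarrow>
      (\<Sum>(a, b)\<in>D. b - a) < d \<Longrightarrow> (\<Sum>(a, b)\<in>D. norm (\<alpha> b - \<alpha> a)) < e"
    using \<alpha> unfolding abs_cont_curve_def by blast
  have "(\<Sum>(a, b)\<in>D. \<bar>\<alpha> (clamp01 b) $ i - \<alpha> (clamp01 a) $ i\<bar>) < e"
    if D: "interval_family D" and small: "(\<Sum>(a, b)\<in>D. b - a) < d" for D
  proof -
    have "mono clamp01" by (auto simp: mono_def clamp01_def)
    then obtain D' where D': "interval_family D'" "D' \<subseteq> map_prod clamp01 clamp01 ` D"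
      "\<And>g :: real \<Rightarrow> real \<Rightarrow> real. (\<And>x. g x x = 0) \<Longrightarrow>
        (\<Sum>(a, b)\<in>D'. g a b) = (\<Sum>(a, b)\<in>D. g (clamp01 a) (clamp01 b))"
      using interval_family_push[OF D] by blast
    have "(\<Sum>(a, b)\<in>D'. b - a) = (\<Sum>(a, b)\<in>D. clamp01 b - clamp01 a)"
      using D'(3)[of "\<lambda>a b. b - a"] by simp
    also have "\<dots> \<le> (\<Sum>(a, b)\<in>D. b - a)"
    proof (rule sum_mono)
      fix p assume "p \<in> D"
      then have "fst p < snd p" by (rule interval_family_less[OF D])
      then show "(case p of (a, b) \<Rightarrow> clamp01 b - clamp01 a) \<le> (case p of (a, b) \<Rightarrow> b - a)"
        by (auto simp: case_prod_unfold clamp01_def)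
    qed
    also note small
    finally have len: "(\<Sum>(a, b)\<in>D'. b - a) < d" .
    have "\<forall>(a, b)\<in>D'. 0 \<le> a \<and> a \<le> b \<and> b \<le> 1"
    proof
      fix p assume p: "p \<in> D'"
      then have "fst p < snd p" by (rule interval_family_less[OF D'(1)])
      moreover have "0 \<le> fst p" "snd p \<le> 1" using subsetD[OF D'(2) p] by auto
      ultimately show "case p of (a, b) \<Rightarrow> 0 \<le> a \<and> a \<le> b \<and> b \<le> 1" by (simp add: case_prod_unfold)
    qed
    moreover have "pairwise (\<lambda>(a, b) (c, d). disjnt {a<..<b} {c<..<d}) D'"
      using interval_family_disjnt[OF D'(1)] by (simp add: pairwise_def case_prod_unfold)
    ultimately have *: "(\<Sum>(a, b)\<in>D'. norm (\<alpha> b - \<alpha> a)) < e"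
      using interval_family_finite[OF D'(1)] len by (intro d(2))
    have "(\<Sum>(a, b)\<in>D. \<bar>\<alpha> (clamp01 b) $ i - \<alpha> (clamp01 a) $ i\<bar>) = (\<Sum>(a, b)\<in>D'. \<bar>\<alpha> b $ i - \<alpha> a $ i\<bar>)"
      using D'(3)[of "\<lambda>a b. \<bar>\<alpha> b $ i - \<alpha> a $ i\<bar>"] by simp
    also have "\<dots> \<le> (\<Sum>(a, b)\<in>D'. norm (\<alpha> b - \<alpha> a))"
    proof (rule sum_mono)
      fix p assume "p \<in> D'"
      show "(case p of (a, b) \<Rightarrow> \<bar>\<alpha> b $ i - \<alpha> a $ i\<bar>) \<le> (case p of (a, b) \<Rightarrow> norm (\<alpha> b - \<alpha> a))"
        using component_le_norm_cart[of "\<alpha> (snd p) - \<alpha> (fst p)" i] by (simp add: case_prod_unfold)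
    qed
    also note *
    finally show ?thesis .
  qed
  with d(1) show "\<exists>d>0. \<forall>D. interval_family D \<longrightarrow> (\<Sum>(a, b)\<in>D. b - a) < d \<longrightarrow>
     (\<Sum>(a, b)\<in>D. \<bar>\<alpha> (clamp01 b) $ i - \<alpha> (clamp01 a) $ i\<bar>) < e" by blast
qed

lemma vec_eq_sum_axis:
  fixes x :: "real ^ 'n"
  shows "(\<Sum>i\<in>UNIV. (x $ i) *\<^sub>R axis i 1) = x"
  using basis_expansion[of x] by (simp add: scalar_mult_eq_scaleR)

text \<open>
  The fundamental theorem of calculus for absolutely continuous curves, applied below both to the
  given curve and to its Lipschitz reparametrization. The density is taken to vanish outside the open unit
  interval so that integrals over the line and over the unit interval agree.
\<close>

theorem abs_cont_curve_ex_density: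
  fixes \<alpha> :: "real \<Rightarrow> real ^ 'n"
  assumes \<alpha>: "abs_cont_curve \<alpha>"
  shows "\<exists>g. integrable lborel g \<and> (\<forall>t. t \<notin> {0<..<1} \<longrightarrow> g t = 0) \<and>
    (\<forall>a b. 0 \<le> a \<longrightarrow> a \<le> b \<longrightarrow> b \<le> 1 \<longrightarrow> \<alpha> b - \<alpha> a = (LINT t:{a..b}|lborel. g t)) \<and>
    (AE t in lborel. t \<in> {0<..<1} \<longrightarrow> (\<alpha> has_vector_derivative g t) (at t))"
proof -
  define F where "F = (\<lambda>i t. \<alpha> (clamp01 t) $ i)"
  have "\<exists>h :: real \<Rightarrow> real. integrable lborel h \<and> (\<forall>a b. a \<le> b \<longrightarrow> F i b - F i a = (LINT t:{a..b}|lborel. h t))" for i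
    unfolding F_def by (intro AC_ex_density abs_cont_curve_imp_AC_component[OF \<alpha>]) simp_all
  then obtain h where h: "\<And>i. integrable lborel (h i)"
    "\<And>i a b. a \<le> b \<Longrightarrow> F i b - F i a = (LINT t:{a..b}|lborel. h i t)" by metis
  define g where "g = (\<lambda>t. \<Sum>i\<in>UNIV. h i t *\<^sub>R axis i (1::real))"
  have g_nth: "g t $ i = h i t" for t i
    by (simp add: g_def axis_def if_distrib cong: if_cong)
  have g: "integrable lborel g"
    unfolding g_def using h(1) by (intro Bochner_Integration.integrable_sum integrable_scaleR_left) auto
  have eq: "\<alpha> b - \<alpha> a = (LINT t:{a..b}|lborel. g t)" if "0 \<le> a" "a \<le> b" "b \<le> 1" for a b
  proof (subst vec_eq_iff, rule allI)
    fix i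
    have "integrable lborel (\<lambda>t. indicator {a..b} t *\<^sub>R g t)"
      using g by (intro integrable_mult_indicator) auto
    then have "(LINT t:{a..b}|lborel. g t) $ i = (LINT t|lborel. (indicator {a..b} t *\<^sub>R g t) $ i)"
      unfolding set_lebesgue_integral_def by (rule integral_bounded_linear[OF bounded_linear_vec_nth, symmetric])
    also have "\<dots> = (LINT t:{a..b}|lborel. h i t)"
      by (simp add: set_lebesgue_integral_def g_nth)
    also have "\<dots> = (\<alpha> b - \<alpha> a) $ i"
      using h(2)[of a b i] that by (simp add: F_def)
    finally show "(\<alpha> b - \<alpha> a) $ i = (LINT t:{a..b}|lborel. g t) $ i" by simp
  qed
  have "AE t in lborel. \<forall>i\<in>UNIV. (F i has_real_derivative h i t) (at t)"
    using h by (intro AE_finite_allI AE_has_real_derivative_indefinite_integral) auto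
  then have "AE t in lborel. t \<in> {0<..<1} \<longrightarrow> (\<alpha> has_vector_derivative g t) (at t)"
  proof eventually_elim
    case (elim t)
    show ?case
    proof
      assume t: "t \<in> {0<..<1}"
      have "((\<lambda>u. \<Sum>i\<in>UNIV. F i u *\<^sub>R axis i (1::real)) has_vector_derivative g t) (at t)"
        unfolding g_def has_vector_derivative_def scaleR_right.sum
      proof (intro has_derivative_sum)
        fix i :: 'n
        have "(F i has_derivative (*) (h i t)) (at t)"
          using elim by (simp add: has_field_derivative_def)
        then show "((\<lambda>u. F i u *\<^sub>R axis i (1::real)) has_derivative (\<lambda>x. x *\<^sub>R h i t *\<^sub>R axis i 1)) (at t)"
          by (auto intro!: derivative_eq_intros simp: fun_eq_iff mult.commute)
      qed
      then show "(\<alpha> has_vector_derivative g t) (at t)"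
        by (rule has_vector_derivative_transform_within_open[where S = "{0<..<1}"])
           (use t in \<open>auto simp: F_def vec_eq_sum_axis\<close>)
    qed
  qed
  \<comment> \<open>Forcing the density to vanish off the open interval changes nothing inside it.\<close>
  define g0 where "g0 = (\<lambda>t. indicator {0<..<1::real} t *\<^sub>R g t)"
  have "integrable lborel g0" unfolding g0_def using g by (intro integrable_mult_indicator) auto
  moreover have "\<alpha> b - \<alpha> a = (LINT t:{a..b}|lborel. g0 t)" if "0 \<le> a" "a \<le> b" "b \<le> 1" for a b
  proof -
    have [measurable]: "g \<in> borel_measurable lborel" using g by (rule borel_measurable_integrable)
    have "AE t in lborel. t \<noteq> 0 \<and> t \<noteq> (1 :: real)"
      using AE_lborel_singleton[of "0::real"] AE_lborel_singleton[of "1::real"] by eventually_elim simp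
    then have "AE t in lborel. t \<in> {a..b} \<longrightarrow> g0 t = g t"
      by eventually_elim (use that in \<open>auto simp: g0_def\<close>)
    then have "(LINT t:{a..b}|lborel. g0 t) = (LINT t:{a..b}|lborel. g t)"
      unfolding g0_def by (intro set_lebesgue_integral_cong_AE) simp_all
    then show ?thesis using eq[OF that] by simp
  qed
  moreover have "AE t in lborel. t \<in> {0<..<1} \<longrightarrow> (\<alpha> has_vector_derivative g0 t) (at t)"
    using \<open>AE t in lborel. t \<in> {0<..<1} \<longrightarrow> (\<alpha> has_vector_derivative g t) (at t)\<close>
    by eventually_elim (auto simp: g0_def)
  moreover have "g0 t = 0" if "t \<notin> {0<..<1}" for t using that by (simp add: g0_def)
  ultimately show ?thesis by blast
qed

section \<open>Distribution functions on the unit interval and their right-continuous inverses\<close>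

lemma set_integral_atMost_diff:
  fixes h :: "real \<Rightarrow> real"
  assumes h: "integrable lborel h" and "a \<le> b"
  shows "(LINT t:{..b}|lborel. h t) - (LINT t:{..a}|lborel. h t) = (LINT t:{a..b}|lborel. h t)"
proof -
  have i: "set_integrable lborel A h" if "A \<in> sets borel" for A
    unfolding set_integrable_def using h that by (intro integrable_mult_indicator) auto
  have "{..a} \<union> {a..b} = {..b}" using \<open>a \<le> b\<close> by auto
  moreover have "AE t in lborel. \<not> (t \<in> {..a} \<and> t \<in> {a..b})"
    using AE_lborel_singleton[of a] by eventually_elim auto
  ultimately show ?thesis
    using set_integral_Un_AE[where M = lborel and A = "{..a}" and B = "{a..b}" and f = h] i by simp
qed

lemma continuous_set_integral_atMost:
  fixes h :: "real \<Rightarrow> real"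
  assumes h: "integrable lborel h"
  shows "isCont (\<lambda>x. LINT t:{..x}|lborel. h t) x"
  unfolding continuous_at_sequentially
proof (intro allI impI)
  fix u assume u: "u \<longlonglongrightarrow> x"
  have [measurable]: "h \<in> borel_measurable lborel" using h by (rule borel_measurable_integrable)
  have "(\<lambda>n. LINT t|lborel. indicator {..u n} t *\<^sub>R h t) \<longlonglongrightarrow> (LINT t|lborel. indicator {..x} t *\<^sub>R h t)"
  proof (rule integral_dominated_convergence[where w = "\<lambda>t. norm (h t)"])
    show "AE t in lborel. (\<lambda>n. indicator {..u n} t *\<^sub>R h t) \<longlonglongrightarrow> indicator {..x} t *\<^sub>R h t"
      using AE_lborel_singleton[of x]
    proof eventually_elim
      case (elim t)
      have "eventually (\<lambda>n. indicator {..u n} t *\<^sub>R h t = indicator {..x} t *\<^sub>R h t) sequentially"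
      proof (cases "t < x")
        case True
        from order_tendstoD(1)[OF u this] show ?thesis
          by (rule eventually_mono) (use True in auto)
      next
        case False
        with elim have "x < t" by simp
        from order_tendstoD(2)[OF u this] show ?thesis
          by (rule eventually_mono) (use \<open>x < t\<close> in auto)
      qed
      then show ?case by (rule tendsto_eventually)
    qed
    show "AE t in lborel. norm (indicator {..u n} t *\<^sub>R h t) \<le> norm (h t)" for n
      by (intro AE_I2) (simp split: split_indicator)
  qed (use h in auto)
  then show "((\<lambda>x. LINT t:{..x}|lborel. h t) \<circ> u) \<longlonglongrightarrow> (LINT t:{..x}|lborel. h t)"
    by (simp add: o_def set_lebesgue_integral_def)
qed

text \<open>
  The density \<open>m\<close> will be the normalised speed of a curve, \<open>mass\<close> its normalised arc length, and \<open>quantile\<close>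
  the change of parameter.
\<close>

locale unit_interval_density =
  fixes m :: "real \<Rightarrow> real"
  assumes integrable_m: "integrable lborel m"
    and m_nonneg: "0 \<le> m t"
    and m_outside: "t \<notin> {0<..<1} \<Longrightarrow> m t = 0"
    and total_mass: "(LINT t|lborel. m t) = 1"
begin

definition mass :: "real \<Rightarrow> real" where
  "mass t = (LINT u:{..t}|lborel. m u)"

definition quantile :: "real \<Rightarrow> real" where
  "quantile s = Sup {t \<in> {0..1}. mass t \<le> s}"

lemma borel_measurable_m [measurable]: "m \<in> borel_measurable borel"
  using borel_measurable_integrable[OF integrable_m] by simp

lemma mass_diff: "a \<le> b \<Longrightarrow> mass b - mass a = (LINT u:{a..b}|lborel. m u)"
  unfolding mass_def by (rule set_integral_atMost_diff[OF integrable_m])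

lemma mono_mass: "mono mass"
proof (rule monoI)
  fix a b :: real assume "a \<le> b"
  have "0 \<le> (LINT u:{a..b}|lborel. m u)"
    unfolding set_lebesgue_integral_def using m_nonneg by (intro integral_nonneg_AE AE_I2) simp
  with mass_diff[OF \<open>a \<le> b\<close>] show "mass a \<le> mass b" by simp
qed

lemma mass_eq_0: "t \<le> 0 \<Longrightarrow> mass t = 0"
proof -
  assume "t \<le> 0"
  then have "(\<lambda>u. indicator {..t} u *\<^sub>R m u) = (\<lambda>u. 0)"
    using m_outside by (fastforce simp: fun_eq_iff split: split_indicator)
  then show ?thesis by (simp add: mass_def set_lebesgue_integral_def)
qed

lemma mass_eq_1: "1 \<le> t \<Longrightarrow> mass t = 1"
proof -
  assume "1 \<le> t"
  then have "(\<lambda>u. indicator {..t} u *\<^sub>R m u) = m"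
    using m_outside by (fastforce simp: fun_eq_iff split: split_indicator)
  then show ?thesis by (simp add: mass_def set_lebesgue_integral_def total_mass)
qed

lemma mass_bounds: "0 \<le> mass t" "mass t \<le> 1"
  using monoD[OF mono_mass, of "min t 0" t] monoD[OF mono_mass, of t "max t 1"]
    mass_eq_0[of "min t 0"] mass_eq_1[of "max t 1"] by simp_all

lemma isCont_mass: "isCont mass t"
  unfolding mass_def by (rule continuous_set_integral_atMost[OF integrable_m])

lemma AE_mass_has_derivative: "AE t in lborel. (mass has_real_derivative m t) (at t)"
  by (rule AE_has_real_derivative_indefinite_integral[OF integrable_m mass_diff])

lemma le_quantile:
  assumes "t \<in> {0..1}" "mass t \<le> s"
  shows "t \<le> quantile s"
  unfolding quantile_def using assms by (intro cSup_upper bdd_aboveI[of _ 1]) auto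

lemma quantile_mem:
  assumes "0 \<le> s"
  shows "quantile s \<in> {0..1}"
proof -
  have "0 \<le> quantile s" using assms mass_eq_0[of 0] by (intro le_quantile) auto
  moreover have "quantile s \<le> 1"
    unfolding quantile_def
  proof (rule cSup_least)
    have "0 \<in> {t \<in> {0..1}. mass t \<le> s}" using assms mass_eq_0[of 0] by simp
    then show "{t \<in> {0..1}. mass t \<le> s} \<noteq> {}" by blast
  qed auto
  ultimately show ?thesis by simp
qed

lemma mass_quantile:
  assumes "s \<in> {0..1}"
  shows "mass (quantile s) = s"
proof (rule antisym)
  let ?A = "{t \<in> {0..1}. mass t \<le> s}"
  have "closed ({0..1} \<inter> mass -` {..s})"
    using isCont_mass by (intro continuous_closed_vimage closed_Int) auto
  moreover have "{0..1} \<inter> mass -` {..s} = ?A" by auto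
  ultimately have "closed ?A" by simp
  moreover have "0 \<in> ?A" using assms mass_eq_0[of 0] by simp
  moreover have "bdd_above ?A" by (intro bdd_aboveI[of _ 1]) auto
  ultimately have "Sup ?A \<in> ?A" by (intro closed_contains_Sup; blast)
  then show "mass (quantile s) \<le> s" by (simp add: quantile_def)
  obtain t where t: "0 \<le> t" "t \<le> 1" "mass t = s"
    using IVT[of mass 0 s 1] assms isCont_mass mass_eq_0[of 0] mass_eq_1[of 1] by auto
  then have "t \<le> quantile s" by (intro le_quantile) auto
  then show "s \<le> mass (quantile s)" using monoD[OF mono_mass, of t "quantile s"] t by simp
qed

lemma strict_mono_on_quantile: "strict_mono_on {0..1} quantile"
proof (rule strict_mono_onI)
  fix r s :: real assume rs: "r \<in> {0..1}" "s \<in> {0..1}" "r < s"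
  then have "mass (quantile r) < mass (quantile s)" by (simp add: mass_quantile)
  then show "quantile r < quantile s"
    using monoD[OF mono_mass, of "quantile s" "quantile r"] by (meson not_le)
qed

text \<open>
  The Galois connection between distribution function and quantile function. It gives right-continuity of
  the quantile function as well as the preimages of half-lines under \<open>mass\<close>.
\<close>

lemma less_mass_iff:
  assumes "s \<in> {0..<1}"
  shows "s < mass t \<longleftrightarrow> quantile s < t"
proof
  assume "s < mass t"
  then have "mass (quantile s) < mass t" using assms by (simp add: mass_quantile)
  then show "quantile s < t" using monoD[OF mono_mass, of t "quantile s"] by (meson not_le)
next
  assume less: "quantile s < t"
  show "s < mass t"
  proof (cases "t \<le> 1")
    case True
    then have "t \<in> {0..1}" using less quantile_mem[of s] assms by auto
    then show ?thesis using le_quantile[of t s] less by (meson not_le)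
  next
    case False
    then show ?thesis using mass_eq_1[of t] assms by simp
  qed
qed

lemma continuous_at_right_quantile:
  assumes s: "s \<in> {0..<1}"
  shows "continuous (at_right s) quantile"
  unfolding continuous_within
proof (rule order_tendstoI)
  fix a assume "a < quantile s"
  have "eventually (\<lambda>r. r \<in> {s<..<1}) (at_right s)"
    using s by (intro eventually_at_right_real) auto
  then show "eventually (\<lambda>r. a < quantile r) (at_right s)"
  proof (rule eventually_mono)
    fix r assume "r \<in> {s<..<1}"
    then show "a < quantile r"
      using strict_mono_onD[OF strict_mono_on_quantile, of s r] s \<open>a < quantile s\<close> by auto
  qed
next
  fix a assume a: "quantile s < a"
  then have "s < mass a" using s by (simp add: less_mass_iff)
  moreover have "s < 1" using s by simp
  ultimately have "eventually (\<lambda>r. r \<in> {s<..<min 1 (mass a)}) (at_right s)"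
    by (intro eventually_at_right_real) auto
  then show "eventually (\<lambda>r. quantile r < a) (at_right s)"
  proof (rule eventually_mono)
    fix r assume "r \<in> {s<..<min 1 (mass a)}"
    then show "quantile r < a" using less_mass_iff[of r a] s by auto
  qed
qed

lemma borel_measurable_mass [measurable]: "mass \<in> borel_measurable borel"
  by (rule borel_measurable_mono[OF mono_mass])

lemma emeasure_density_greaterThan: "emeasure (density lborel m) {y<..} = ennreal (1 - mass y)"
proof -
  have i: "integrable lborel (\<lambda>t. indicator A t * m t)" if "A \<in> sets borel" for A
    using integrable_mult_indicator[of A lborel m] that integrable_m by simp
  have "emeasure (density lborel m) {y<..} = (\<integral>\<^sup>+t. ennreal (indicator {y<..} t * m t) \<partial>lborel)"
    by (subst emeasure_density) (auto intro!: nn_integral_cong split: split_indicator)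
  also have "\<dots> = ennreal (LINT t|lborel. indicator {y<..} t * m t)"
    using m_nonneg by (intro nn_integral_eq_integral i AE_I2) auto
  also have "(LINT t|lborel. indicator {y<..} t * m t) = (LINT t|lborel. m t - indicator {..y} t * m t)"
    by (intro Bochner_Integration.integral_cong) (auto split: split_indicator)
  also have "\<dots> = 1 - mass y"
    using integrable_m i by (subst Bochner_Integration.integral_diff)
      (auto simp: total_mass mass_def set_lebesgue_integral_def)
  finally show ?thesis .
qed

text \<open>
  The probability integral transform: the distribution function pushes its own measure forward to
  the uniform distribution. This is the substitution rule for \<open>s = mass t\<close>.
\<close>

theorem distr_mass: "distr (density lborel m) borel mass = density lborel (indicator {0..1})"
proof (rule measure_eqI_lessThan)
  fix x :: real
  have l: "emeasure (distr (density lborel m) borel mass) {x<..} = emeasure (density lborel m) {t. x < mass t}"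
    by (subst emeasure_distr) (auto simp: vimage_def)
  have r: "emeasure (density lborel (indicator {0..1})) {x<..} = emeasure lborel ({0..1} \<inter> {x<..})"
    by (subst emeasure_density) (auto simp: nn_integral_indicator simp flip: indicator_inter_arith)
  consider "x < 0" | "x \<in> {0..<1}" | "1 \<le> x" by force
  then show eq: "emeasure (distr (density lborel m) borel mass) {x<..} = emeasure (density lborel (indicator {0..1})) {x<..}"
  proof cases
    case 1
    have "{t. x < mass t} = UNIV" using 1 mass_bounds(1) by (auto intro: less_le_trans)
    moreover have "emeasure (density lborel m) UNIV = ennreal (LINT t|lborel. m t)"
      using m_nonneg integrable_m by (subst emeasure_density) (auto intro!: nn_integral_eq_integral)
    moreover have "{0..1} \<inter> {x<..} = {0..1}" using 1 by auto
    ultimately show ?thesis unfolding l r by (simp add: total_mass)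
  next
    case 2
    have "{t. x < mass t} = {quantile x<..}" using less_mass_iff[OF 2] by auto
    moreover have "mass (quantile x) = x" using 2 by (intro mass_quantile) auto
    moreover have "{0..1} \<inter> {x<..} = {x<..1}" using 2 by auto
    ultimately show ?thesis unfolding l r using 2 by (simp add: emeasure_density_greaterThan)
  next
    case 3
    have "{t. x < mass t} = {}" using 3 mass_bounds(2) by (auto simp: not_less intro: order_trans)
    moreover have "{0..1} \<inter> {x<..} = {}" using 3 by auto
    ultimately show ?thesis unfolding l r by simp
  qed
  have "emeasure lborel ({0..1} \<inter> {x<..}) \<le> emeasure lborel {0..1::real}" by (intro emeasure_mono) auto
  then show "emeasure (distr (density lborel m) borel mass) {x<..} < \<infinity>"
    unfolding eq r by (simp add: le_less_trans)
qed simp_all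

end

section \<open>Parametrization by normalised arc length\<close>

lemma hom_ext_scaleR_nonneg:
  assumes "0 \<le> c"
  shows "hom_ext f (c *\<^sub>R v) = c * hom_ext f v"
proof (cases "c = 0")
  case False
  with assms have "(c *\<^sub>R v) /\<^sub>R norm (c *\<^sub>R v) = v /\<^sub>R norm v" by simp
  with assms show ?thesis by (simp only: hom_ext_def norm_scaleR abs_of_nonneg mult.assoc)
qed (simp add: hom_ext_def)

lemma borel_measurable_hom_ext:
  fixes f :: "'n::finite proj_space \<Rightarrow> real"
  assumes f: "continuous_on UNIV f"
  shows "hom_ext f \<in> borel_measurable borel"
proof -
  have proj: "continuous_on (sphere 0 1) (proj :: real ^ 'n \<Rightarrow> _)"
    using quotient_imp_continuous_map[OF quotient_map_proj] by simp
  have "continuous_on (- {0}) (\<lambda>v :: real ^ 'n. v /\<^sub>R norm v)"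
    by (intro continuous_intros) auto
  moreover have "v /\<^sub>R norm v \<in> sphere 0 1" if "v \<noteq> 0" for v :: "real ^ 'n"
    using that by simp
  ultimately have "continuous_on (- {0}) (\<lambda>v :: real ^ 'n. f (proj (v /\<^sub>R norm v)))"
    by (intro continuous_on_compose2[OF f] continuous_on_compose2[OF proj]) blast+
  then have "continuous_on (- {0}) (hom_ext f)"
    unfolding hom_ext_def by (intro continuous_intros)
  then have "(\<lambda>v. indicator (- {0}) v *\<^sub>R hom_ext f v) \<in> borel_measurable borel"
    by (intro borel_measurable_continuous_on_indicator) auto
  moreover have "(\<lambda>v. indicator (- {0}) v *\<^sub>R hom_ext f v) = hom_ext f"
    by (auto simp: fun_eq_iff hom_ext_def split: split_indicator)
  ultimately show ?thesis by simp
qed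

text \<open>
  The derivative may be replaced by a Borel density although it is defined only almost everywhere: the
  integrands agree almost everywhere, and completeness of Lebesgue measure supplies the measurability.
\<close>

lemma set_integral_vector_derivative:
  fixes H :: "real ^ 'n \<Rightarrow> real" and g :: "real \<Rightarrow> real ^ 'n"
  assumes [measurable]: "H \<in> borel_measurable borel" "g \<in> borel_measurable borel"
    and deriv: "AE t in lborel. t \<in> {0<..<1} \<longrightarrow> (\<alpha> has_vector_derivative g t) (at t)"
  shows "(LINT t:{0..1}|lebesgue. H (vector_derivative \<alpha> (at t within {0..1}))) =
    (LINT t:{0..1}|lborel. H (g t))"
proof -
  let ?X = "\<lambda>t. indicator {0..1} t *\<^sub>R H (vector_derivative \<alpha> (at t within {0..1}))"
  let ?Y = "\<lambda>t. indicator {0..1} t *\<^sub>R H (g t)"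
  have "AE t in lborel. t \<noteq> 0 \<and> t \<noteq> (1 :: real)"
    using AE_lborel_singleton[of "0::real"] AE_lborel_singleton[of "1::real"] by eventually_elim simp
  with deriv have "AE t in lborel. ?Y t = ?X t"
  proof eventually_elim
    case (elim t)
    then show ?case
      using vector_derivative_at_within_ivl[of \<alpha> "g t" t 0 1] by (auto split: split_indicator)
  qed
  then have ae: "AE t in lebesgue. ?Y t = ?X t" by (rule AE_completion)
  have Y: "?Y \<in> borel_measurable lborel" by measurable
  then have "?Y \<in> borel_measurable lebesgue" by (rule measurable_completion)
  then have "integral\<^sup>L lebesgue ?X = integral\<^sup>L lebesgue ?Y"
    using ae borel_measurable_AE[OF _ ae] by (intro integral_cong_AE) auto
  also have "\<dots> = integral\<^sup>L lborel ?Y" by (rule integral_completion[OF Y])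
  finally show ?thesis by (simp only: set_lebesgue_integral_def)
qed

text \<open>
  The curve enters the defining property of its measure only through these integrals, so equal
  integrals give literally the same description.
\<close>

lemma curve_measure_eqI:
  assumes "\<And>f. continuous_on UNIV f \<Longrightarrow>
    (LINT t:{0..1}|lebesgue. hom_ext f (vector_derivative \<alpha> (at t within {0..1}))) =
    (LINT t:{0..1}|lebesgue. hom_ext f (vector_derivative \<beta> (at t within {0..1})))"
  shows "curve_measure \<alpha> = curve_measure \<beta>"
proof -
  have "(\<forall>f. continuous_on UNIV f \<longrightarrow> (\<integral>p. f p \<partial>\<mu>) =
      (LINT t:{0..1}|lebesgue. hom_ext f (vector_derivative \<alpha> (at t within {0..1})))) \<longleftrightarrow>
    (\<forall>f. continuous_on UNIV f \<longrightarrow> (\<integral>p. f p \<partial>\<mu>) =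
      (LINT t:{0..1}|lebesgue. hom_ext f (vector_derivative \<beta> (at t within {0..1}))))" for \<mu>
    using assms by auto
  then show ?thesis unfolding curve_measure_def by simp
qed

lemma lipschitz_imp_abs_cont_curve:
  fixes \<beta> :: "real \<Rightarrow> real ^ 'n"
  assumes "L > 0"
    and lip: "\<And>a b. 0 \<le> a \<Longrightarrow> a \<le> b \<Longrightarrow> b \<le> 1 \<Longrightarrow> norm (\<beta> b - \<beta> a) \<le> L * (b - a)"
  shows "abs_cont_curve \<beta>"
  unfolding abs_cont_curve_def
proof (intro allI impI)
  fix e :: real assume "e > 0"
  have "(\<Sum>(a, b)\<in>D. norm (\<beta> b - \<beta> a)) < e"
    if D: "\<forall>(a, b)\<in>D. 0 \<le> a \<and> a \<le> b \<and> b \<le> 1" and small: "(\<Sum>(a, b)\<in>D. b - a) < e / L"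
    for D :: "(real \<times> real) set"
  proof -
    have "(\<Sum>(a, b)\<in>D. norm (\<beta> b - \<beta> a)) \<le> (\<Sum>(a, b)\<in>D. L * (b - a))"
      using D lip by (intro sum_mono) auto
    also have "\<dots> = L * (\<Sum>(a, b)\<in>D. b - a)" by (simp add: sum_distrib_left case_prod_unfold)
    also have "\<dots> < e" using small \<open>L > 0\<close> by (simp add: field_simps)
    finally show ?thesis .
  qed
  then show "\<exists>\<delta>>0. \<forall>D :: (real \<times> real) set. finite D \<longrightarrow> (\<forall>(a, b)\<in>D. 0 \<le> a \<and> a \<le> b \<and> b \<le> 1) \<longrightarrow>
        pairwise (\<lambda>(a, b) (c, d). disjnt {a<..<b} {c<..<d}) D \<longrightarrow>
        (\<Sum>(a, b)\<in>D. b - a) < \<delta> \<longrightarrow> (\<Sum>(a, b)\<in>D. norm (\<beta> b - \<beta> a)) < e"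
    using \<open>e > 0\<close> \<open>L > 0\<close> by (intro exI[of _ "e / L"]) simp
qed

lemma reparametrization_refl:
  assumes "abs_cont_curve \<alpha>"
  shows "reparametrization \<alpha> \<alpha>"
  unfolding reparametrization_def
proof (intro conjI bexI[of _ id])
  show "strict_mono_on {0..1} id \<or> strict_antimono_on {0..1} (id :: real \<Rightarrow> real)"
    by (intro disjI1 strict_mono_onI) simp
qed (use assms in auto)

lemma constant_speed_if_constant:
  assumes "\<And>t. t \<in> {0..1} \<Longrightarrow> \<alpha> t = \<alpha> 0"
  shows "constant_speed \<alpha>"
  unfolding constant_speed_def
proof (rule exI[of _ 0], intro AE_I2 impI)
  fix s :: real assume s: "s \<in> {0..1}"
  have "(\<alpha> has_vector_derivative 0) (at s within {0..1})"
    by (rule has_vector_derivative_transform[where f = "\<lambda>_. \<alpha> 0", OF s assms has_vector_derivative_const])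
  then show "\<exists>v. (\<alpha> has_vector_derivative v) (at s within {0..1}) \<and> norm v = 0" by auto
qed

context
  fixes \<alpha> g :: "real \<Rightarrow> real ^ 'n" and L :: real
  assumes g_int: "integrable lborel g"
    and g_outside: "\<And>t. t \<notin> {0<..<1} \<Longrightarrow> g t = 0"
    and \<alpha>_diff: "\<And>a b. 0 \<le> a \<Longrightarrow> a \<le> b \<Longrightarrow> b \<le> 1 \<Longrightarrow> \<alpha> b - \<alpha> a = (LINT t:{a..b}|lborel. g t)"
    and \<alpha>_deriv: "AE t in lborel. t \<in> {0<..<1} \<longrightarrow> (\<alpha> has_vector_derivative g t) (at t)"
    and L_eq: "L = (LINT t|lborel. norm (g t))" and L_pos: "0 < L"
begin

interpretation unit_interval_density "\<lambda>t. norm (g t) / L"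
proof
  show "integrable lborel (\<lambda>t. norm (g t) / L)" using g_int by simp
  show "(LINT t|lborel. norm (g t) / L) = 1" using L_pos by (simp add: L_eq)
qed (use L_pos g_outside in auto)

lemma norm_diff_le_mass_diff:
  assumes "0 \<le> a" "a \<le> b" "b \<le> 1"
  shows "norm (\<alpha> b - \<alpha> a) \<le> L * (mass b - mass a)"
proof -
  have i: "integrable lborel (\<lambda>t. indicator {a..b} t *\<^sub>R g t)"
    using g_int by (intro integrable_mult_indicator) auto
  have "norm (\<alpha> b - \<alpha> a) \<le> (LINT t|lborel. norm (indicator {a..b} t *\<^sub>R g t))"
    unfolding \<alpha>_diff[OF assms] set_lebesgue_integral_def by (rule integral_norm_bound)
  also have "\<dots> = (LINT t|lborel. L * (indicator {a..b} t *\<^sub>R (norm (g t) / L)))"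
    using L_pos by (intro Bochner_Integration.integral_cong) auto
  also have "\<dots> = L * (mass b - mass a)"
    unfolding mass_diff[OF assms(2)] set_lebesgue_integral_def by (rule integral_mult_right_zero)
  finally show ?thesis .
qed

definition arc_curve :: "real \<Rightarrow> real ^ 'n" where
  "arc_curve s = \<alpha> (quantile s)"

lemma arc_curve_lipschitz:
  assumes "0 \<le> a" "a \<le> b" "b \<le> 1"
  shows "norm (arc_curve b - arc_curve a) \<le> L * (b - a)"
proof -
  have "quantile a \<le> quantile b"
    using assms mass_quantile[of a] by (intro le_quantile quantile_mem) auto
  then have "norm (\<alpha> (quantile b) - \<alpha> (quantile a)) \<le> L * (mass (quantile b) - mass (quantile a))"
    using assms quantile_mem[of a] quantile_mem[of b] by (intro norm_diff_le_mass_diff) auto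
  then show ?thesis using assms by (simp add: arc_curve_def mass_quantile)
qed

lemma arc_curve_mass:
  assumes t: "t \<in> {0..1}"
  shows "arc_curve (mass t) = \<alpha> t"
proof -
  have q: "t \<le> quantile (mass t)" using t by (intro le_quantile) auto
  have "quantile (mass t) \<le> 1" using quantile_mem[OF mass_bounds(1), of t] by simp
  then have "norm (\<alpha> (quantile (mass t)) - \<alpha> t) \<le> L * (mass (quantile (mass t)) - mass t)"
    using t q by (intro norm_diff_le_mass_diff) auto
  also have "\<dots> = 0" using mass_bounds by (simp add: mass_quantile)
  finally show ?thesis by (simp add: arc_curve_def)
qed

text \<open>
  Absolute continuity of the reparametrized curve comes from the Lipschitz bound: the jumps of the
  quantile function skip only intervals on which the original curve stands still.
\<close>

lemma reparametrization_arc_curve: "reparametrization arc_curve \<alpha>"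
  unfolding reparametrization_def
proof (intro conjI bexI[of _ quantile])
  show "abs_cont_curve arc_curve"
    by (rule lipschitz_imp_abs_cont_curve[OF L_pos arc_curve_lipschitz])
  show "\<forall>s\<in>{0..<1}. continuous (at_right s) quantile"
    using continuous_at_right_quantile by blast
  show "quantile \<in> {0..1} \<rightarrow> {0..1}" using quantile_mem by auto
qed (use strict_mono_on_quantile in \<open>auto simp: arc_curve_def\<close>)

text \<open>
  The chain rule for the original curve written as \<open>arc_curve \<circ> mass\<close>. It needs \<open>arc_curve\<close> to be
  differentiable at \<open>mass t\<close>, which may fail for many \<open>t\<close>. But the exceptional parameters \<open>mass t\<close> form a
  null set, which by \<open>distr_mass\<close> pulls back to a set without mass, so \<open>g t\<close> is zero for almost all of
  these \<open>t\<close> and both sides vanish.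
\<close>

lemma AE_density_eq_scaled_arc_density:
  assumes b_deriv: "AE s in lborel. s \<in> {0<..<1} \<longrightarrow> (arc_curve has_vector_derivative b s) (at s)"
  shows "AE t in lborel. g t = (norm (g t) / L) *\<^sub>R b (mass t)"
proof -
  have "AE s in lborel. s \<noteq> 0 \<and> s \<noteq> (1 :: real)"
    using AE_lborel_singleton[of "0::real"] AE_lborel_singleton[of "1::real"] by eventually_elim simp
  with b_deriv have "AE s in lborel. s \<in> {0..1} \<longrightarrow> (arc_curve has_vector_derivative b s) (at s)"
    by eventually_elim auto
  then obtain N where N: "N \<in> null_sets lborel"
    "\<And>s. s \<notin> N \<Longrightarrow> s \<in> {0..1} \<Longrightarrow> (arc_curve has_vector_derivative b s) (at s)"
    unfolding eventually_ae_filter by auto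
  have "AE s in density lborel (indicator {0..1}). s \<notin> N"
    using AE_not_in[OF N(1)] by (subst AE_density) auto
  then have "AE t in density lborel (\<lambda>t. norm (g t) / L). mass t \<notin> N"
    using N(1) unfolding distr_mass[symmetric] by (subst (asm) AE_distr_iff) auto
  then have "AE t in lborel. 0 < norm (g t) / L \<longrightarrow> mass t \<notin> N"
    by (subst (asm) AE_density) auto
  with \<alpha>_deriv AE_mass_has_derivative show ?thesis
  proof eventually_elim
    case (elim t)
    show ?case
    proof (cases "g t = 0")
      case False
      then have t: "t \<in> {0<..<1}" using g_outside by blast
      have "mass t \<notin> N" using elim(3) False L_pos by simp
      then have "(arc_curve has_vector_derivative b (mass t)) (at (mass t))"
        using mass_bounds by (intro N(2)) auto
      moreover have "(mass has_vector_derivative norm (g t) / L) (at t)"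
        using elim(2) by (simp add: has_real_derivative_iff_has_vector_derivative)
      ultimately have "((arc_curve \<circ> mass) has_vector_derivative (norm (g t) / L) *\<^sub>R b (mass t)) (at t)"
        by (rule vector_diff_chain_at[rotated])
      then have "(\<alpha> has_vector_derivative (norm (g t) / L) *\<^sub>R b (mass t)) (at t)"
        by (rule has_vector_derivative_transform_within_open[where S = "{0<..<1}"])
           (use t arc_curve_mass in auto)
      then show ?thesis using elim(1) t by (blast intro: vector_derivative_unique_at)
    qed simp
  qed
qed

text \<open>
  Taking norms in \<open>gb\<close> gives \<open>norm (b (mass t)) = L\<close> wherever \<open>g t\<close> is nonzero. This set has full mass, and
  \<open>distr_mass\<close> turns full mass into full Lebesgue measure.
\<close>

lemma AE_norm_arc_density:
  assumes [measurable]: "b \<in> borel_measurable borel"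
    and gb: "AE t in lborel. g t = (norm (g t) / L) *\<^sub>R b (mass t)"
  shows "AE s in lborel. s \<in> {0..1} \<longrightarrow> norm (b s) = L"
proof -
  have "AE t in lborel. 0 < norm (g t) / L \<longrightarrow> norm (b (mass t)) = L"
    using gb
  proof eventually_elim
    case (elim t)
    show ?case
    proof
      assume pos: "0 < norm (g t) / L"
      have "norm (g t) = norm ((norm (g t) / L) *\<^sub>R b (mass t))" by (rule arg_cong[OF elim])
      also have "\<dots> = norm (g t) / L * norm (b (mass t))" using L_pos by simp
      finally show "norm (b (mass t)) = L" using pos L_pos by (simp add: field_simps)
    qed
  qed
  then have "AE t in density lborel (\<lambda>t. norm (g t) / L). norm (b (mass t)) = L"
    by (subst AE_density) auto
  then have "AE s in density lborel (indicator {0..1}). norm (b s) = L"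
    unfolding distr_mass[symmetric] by (subst AE_distr_iff) auto
  then show ?thesis
    by (subst (asm) AE_density) (auto elim: eventually_mono)
qed

text \<open>
  Homogeneity turns the factor in \<open>gb\<close> into a density, after which the two integrals differ by the
  substitution \<open>s = mass t\<close>.
\<close>

lemma set_integral_arc_density:
  assumes [measurable]: "b \<in> borel_measurable borel"
    and gb: "AE t in lborel. g t = (norm (g t) / L) *\<^sub>R b (mass t)"
    and [measurable]: "H \<in> borel_measurable borel"
    and H: "\<And>c v. 0 \<le> c \<Longrightarrow> H (c *\<^sub>R v) = c * (H v :: real)"
  shows "(LINT t:{0..1}|lborel. H (g t)) = (LINT s:{0..1}|lborel. H (b s))"
proof -
  have [measurable]: "g \<in> borel_measurable borel" using borel_measurable_integrable[OF g_int] by simp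
  have H0: "H 0 = 0" using H[of 0 0] by simp
  have "(LINT t:{0..1}|lborel. H (g t)) = (LINT t|lborel. H (g t))"
    unfolding set_lebesgue_integral_def
  proof (intro Bochner_Integration.integral_cong refl)
    fix t show "indicator {0..1} t *\<^sub>R H (g t) = H (g t)"
      using g_outside[of t] H0 by (auto split: split_indicator)
  qed
  also have "\<dots> = (LINT t|lborel. (norm (g t) / L) *\<^sub>R H (b (mass t)))"
  proof (rule integral_cong_AE)
    show "AE t in lborel. H (g t) = (norm (g t) / L) *\<^sub>R H (b (mass t))"
      using gb
    proof eventually_elim
      case (elim t)
      have "H (g t) = H ((norm (g t) / L) *\<^sub>R b (mass t))" by (rule arg_cong[OF elim])
      also have "\<dots> = (norm (g t) / L) * H (b (mass t))" using L_pos by (intro H) simp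
      finally show ?case by simp
    qed
  qed measurable
  also have "\<dots> = (LINT t|density lborel (\<lambda>t. norm (g t) / L). H (b (mass t)))"
    using L_pos by (intro integral_density[symmetric]) auto
  also have "\<dots> = (LINT s|distr (density lborel (\<lambda>t. norm (g t) / L)) borel mass. H (b s))"
    by (intro integral_distr[symmetric]) measurable
  also have "\<dots> = (LINT s|density lborel (\<lambda>s. ennreal (indicator {0..1} s)). H (b s))"
    unfolding distr_mass by (simp add: ennreal_indicator)
  also have "\<dots> = (LINT s:{0..1}|lborel. H (b s))"
    unfolding set_lebesgue_integral_def by (intro integral_density) auto
  finally show ?thesis .
qed

lemma arc_curve_constant_speed_same_measure:
  "constant_speed arc_curve \<and> curve_measure arc_curve = curve_measure \<alpha>"
proof -
  have g_borel: "g \<in> borel_measurable borel" using borel_measurable_integrable[OF g_int] by simp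
  have "abs_cont_curve arc_curve" using reparametrization_arc_curve by (simp add: reparametrization_def)
  then obtain b where b: "integrable lborel b"
    "AE s in lborel. s \<in> {0<..<1} \<longrightarrow> (arc_curve has_vector_derivative b s) (at s)"
    using abs_cont_curve_ex_density by blast
  have b_borel: "b \<in> borel_measurable borel" using borel_measurable_integrable[OF b(1)] by simp
  note gb = AE_density_eq_scaled_arc_density[OF b(2)]
  have "AE s in lborel. s \<noteq> 0 \<and> s \<noteq> (1 :: real)"
    using AE_lborel_singleton[of "0::real"] AE_lborel_singleton[of "1::real"] by eventually_elim simp
  with b(2) AE_norm_arc_density[OF b_borel gb] have "AE s in lborel. s \<in> {0..1} \<longrightarrow>
      (\<exists>v. (arc_curve has_vector_derivative v) (at s within {0..1}) \<and> norm v = L)"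
  proof eventually_elim
    case (elim s)
    show ?case
    proof
      assume "s \<in> {0..1}"
      with elim have "(arc_curve has_vector_derivative b s) (at s)" "norm (b s) = L" by auto
      then show "\<exists>v. (arc_curve has_vector_derivative v) (at s within {0..1}) \<and> norm v = L"
        using has_vector_derivative_at_within by blast
    qed
  qed
  then have "constant_speed arc_curve"
    unfolding constant_speed_def by (intro exI[of _ L] AE_completion)
  moreover have "curve_measure arc_curve = curve_measure \<alpha>"
  proof (rule curve_measure_eqI)
    fix f :: "'n proj_space \<Rightarrow> real" assume "continuous_on UNIV f"
    then have H: "hom_ext f \<in> borel_measurable borel" by (rule borel_measurable_hom_ext)
    show "(LINT t:{0..1}|lebesgue. hom_ext f (vector_derivative arc_curve (at t within {0..1}))) =
      (LINT t:{0..1}|lebesgue. hom_ext f (vector_derivative \<alpha> (at t within {0..1})))"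
      using set_integral_vector_derivative[OF H b_borel b(2)] set_integral_vector_derivative[OF H g_borel \<alpha>_deriv]
        set_integral_arc_density[OF b_borel gb H hom_ext_scaleR_nonneg] by simp
  qed
  ultimately show ?thesis by blast
qed

end

theorem proposition3:
  fixes \<alpha> :: "real \<Rightarrow> real ^ 'n"
  assumes "abs_cont_curve \<alpha>"
  shows "\<exists>\<beta>. reparametrization \<beta> \<alpha> \<and> constant_speed \<beta> \<and>
    curve_measure \<beta> = curve_measure \<alpha>"
proof -
  obtain g where g: "integrable lborel g" "\<forall>t. t \<notin> {0<..<1} \<longrightarrow> g t = 0"
    "\<forall>a b. 0 \<le> a \<longrightarrow> a \<le> b \<longrightarrow> b \<le> 1 \<longrightarrow> \<alpha> b - \<alpha> a = (LINT t:{a..b}|lborel. g t)"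
    "AE t in lborel. t \<in> {0<..<1} \<longrightarrow> (\<alpha> has_vector_derivative g t) (at t)"
    using abs_cont_curve_ex_density[OF assms] by blast
  define L where "L = (LINT t|lborel. norm (g t))"
  have "0 \<le> L" unfolding L_def by (intro integral_nonneg_AE AE_I2) simp
  show ?thesis
  proof (cases "L = 0")
    case True
    then have "AE t in lborel. g t = 0"
      using integral_nonneg_eq_0_iff_AE[of lborel "\<lambda>t. norm (g t)"] g(1) by (simp add: L_def)
    then have "(LINT u:{0..t}|lborel. g u) = 0" for t
      unfolding set_lebesgue_integral_def by (intro integral_eq_zero_AE) (auto elim: eventually_mono)
    then have "\<alpha> t = \<alpha> 0" if "t \<in> {0..1}" for t
      using g(3)[rule_format, of 0 t] that by simp
    then have "constant_speed \<alpha>" by (rule constant_speed_if_constant)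
    then show ?thesis using reparametrization_refl[OF assms] by blast
  next
    case False
    with \<open>0 \<le> L\<close> have "0 < L" by simp
    note * = g(1) g(2,3)[rule_format] g(4) L_def this
    show ?thesis
      using reparametrization_arc_curve[OF *] arc_curve_constant_speed_same_measure[OF *] by blast
  qed
qed

end
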